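(* Let $R$ be a ring. Then the following are equivalent: (1) $R$ is principally $\delta$-semiperfect; (2) $R$ is principally $\delta$-lifting; (3) $R$ is $\delta$-semiregular.
   Context: Rings have an identity and modules are unital right modules. A submodule $N$ of a module $M$ is $\delta$-small in $M$ if, whenever $M=N+X$ for a submodule $X$ with $M/X$ singular, one has $M=X$. A module $M$ is principally $\delta$-lifting if for each $m\in M$ there is a decomposition $M=A\oplus B$ with $A\leq mR$ and $mR\cap B$ $\delta$-small in $B$. A projective module $P$ is a projective $\delta$-cover of a module $L$ if there is an epimorphism $f:P\to L$ with $\operatorname{Ker} f$ $\delta$-small in $P$. A module $M$ is principally $\delta$-semiperfect if for every $m\in M$ the factor module $M/mR$ has a projective $\delta$-cover. A ring $R$ is principally $\delta$-semiperfect (respectively principally $\delta$-lifting) if the right $R$-module $R_R$ is. A ring $R$ is $\delta$-semiregular if every cyclically presented right $R$-module (i.e. every module isomorphic to $R/aR$ with $a\in R$) has a projective $\delta$-cover. *)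

theory Defs
  imports "HOL-Algebra.QuotRing"
begin

section \<open>Right modules\<close>

text \<open>The modules of the theory \<open>Module\<close> are left modules over commutative rings, so
  right modules over arbitrary rings are introduced here, on the same pattern: a module extends the
  record \<open>ring\<close>, whose multiplicative fields are ignored.\<close>

record ('a, 'b) rmodule = "'b ring" +
  ract :: "'b \<Rightarrow> 'a \<Rightarrow> 'b"  (infixl \<open>\<cdot>\<index>\<close> 70)

locale right_module = R?: ring R + M?: abelian_group M
  for R :: "('a, 'm) ring_scheme" (structure) and M :: "('a, 'b) rmodule" (structure) +
  assumes ract_closed [simp, intro]:
      "\<lbrakk>x \<in> carrier M; r \<in> carrier R\<rbrakk> \<Longrightarrow> x \<cdot>\<^bsub>M\<^esub> r \<in> carrier M"
    and ract_l_distr: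
      "\<lbrakk>x \<in> carrier M; y \<in> carrier M; r \<in> carrier R\<rbrakk> \<Longrightarrow>
       (x \<oplus>\<^bsub>M\<^esub> y) \<cdot>\<^bsub>M\<^esub> r = x \<cdot>\<^bsub>M\<^esub> r \<oplus>\<^bsub>M\<^esub> y \<cdot>\<^bsub>M\<^esub> r"
    and ract_r_distr:
      "\<lbrakk>x \<in> carrier M; r \<in> carrier R; s \<in> carrier R\<rbrakk> \<Longrightarrow>
       x \<cdot>\<^bsub>M\<^esub> (r \<oplus>\<^bsub>R\<^esub> s) = x \<cdot>\<^bsub>M\<^esub> r \<oplus>\<^bsub>M\<^esub> x \<cdot>\<^bsub>M\<^esub> s"
    and ract_assoc:
      "\<lbrakk>x \<in> carrier M; r \<in> carrier R; s \<in> carrier R\<rbrakk> \<Longrightarrow>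
       x \<cdot>\<^bsub>M\<^esub> (r \<otimes>\<^bsub>R\<^esub> s) = (x \<cdot>\<^bsub>M\<^esub> r) \<cdot>\<^bsub>M\<^esub> s"
    and ract_one [simp]:
      "x \<in> carrier M \<Longrightarrow> x \<cdot>\<^bsub>M\<^esub> \<one>\<^bsub>R\<^esub> = x"

definition regular_module :: "('a, 'm) ring_scheme \<Rightarrow> ('a, 'a) rmodule" where
  "regular_module R =
     \<lparr>carrier = carrier R, mult = mult R, one = one R, zero = zero R, add = add R, ract = mult R\<rparr>"

definition right_submodule :: "('a, 'm) ring_scheme \<Rightarrow> ('a, 'b) rmodule \<Rightarrow> 'b set \<Rightarrow> bool" where
  "right_submodule R M N \<longleftrightarrow>
     additive_subgroup N M \<and> (\<forall>x\<in>N. \<forall>r\<in>carrier R. x \<cdot>\<^bsub>M\<^esub> r \<in> N)"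

text \<open>A submodule \<open>N\<close> regarded as a module in its own right is \<open>M\<lparr>carrier := N\<rparr>\<close>.\<close>

definition principal_submodule ::
  "('a, 'm) ring_scheme \<Rightarrow> ('a, 'b) rmodule \<Rightarrow> 'b \<Rightarrow> 'b set" where
  "principal_submodule R M m = (\<lambda>r. m \<cdot>\<^bsub>M\<^esub> r) ` carrier R"

text \<open>The action on cosets is \<open>(X + x) r = X + x r\<close>, written as a union over representatives
  as in \<^const>\<open>rcoset_mult\<close>; the fields \<open>mult\<close> and \<open>one\<close> are junk.\<close>

definition quot_module :: "('a, 'b) rmodule \<Rightarrow> 'b set \<Rightarrow> ('a, 'b set) rmodule" where
  "quot_module M X =
     \<lparr>carrier = a_rcosets\<^bsub>M\<^esub> X, mult = (\<lambda>_ _. X), one = X, zero = X, add = set_add M,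
      ract = (\<lambda>C r. \<Union>x\<in>C. X +>\<^bsub>M\<^esub> (x \<cdot>\<^bsub>M\<^esub> r))\<rparr>"

definition direct_decomposition ::
  "('a, 'm) ring_scheme \<Rightarrow> ('a, 'b) rmodule \<Rightarrow> 'b set \<Rightarrow> 'b set \<Rightarrow> bool" where
  "direct_decomposition R M A B \<longleftrightarrow>
     right_submodule R M A \<and> right_submodule R M B \<and>
     carrier M = A <+>\<^bsub>M\<^esub> B \<and> A \<inter> B = {\<zero>\<^bsub>M\<^esub>}"

definition rmodule_hom ::
  "('a, 'm) ring_scheme \<Rightarrow> ('a, 'b) rmodule \<Rightarrow> ('a, 'c) rmodule \<Rightarrow> ('b \<Rightarrow> 'c) set" where
  "rmodule_hom R M N =
     {f \<in> carrier M \<rightarrow> carrier N.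
        (\<forall>x\<in>carrier M. \<forall>y\<in>carrier M. f (x \<oplus>\<^bsub>M\<^esub> y) = f x \<oplus>\<^bsub>N\<^esub> f y) \<and>
        (\<forall>x\<in>carrier M. \<forall>r\<in>carrier R. f (x \<cdot>\<^bsub>M\<^esub> r) = f x \<cdot>\<^bsub>N\<^esub> r)}"

definition rmodule_epi ::
  "('a, 'm) ring_scheme \<Rightarrow> ('a, 'b) rmodule \<Rightarrow> ('a, 'c) rmodule \<Rightarrow> ('b \<Rightarrow> 'c) set" where
  "rmodule_epi R M N = {f \<in> rmodule_hom R M N. f ` carrier M = carrier N}"

definition rmodule_isomorphic ::
  "('a, 'm) ring_scheme \<Rightarrow> ('a, 'b) rmodule \<Rightarrow> ('a, 'c) rmodule \<Rightarrow> bool" where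
  "rmodule_isomorphic R M N \<longleftrightarrow>
     (\<exists>f\<in>rmodule_hom R M N. bij_betw f (carrier M) (carrier N))"


section \<open>Singular modules and \<open>\<delta>\<close>-small submodules\<close>

definition essential_submodule ::
  "('a, 'm) ring_scheme \<Rightarrow> ('a, 'b) rmodule \<Rightarrow> 'b set \<Rightarrow> bool" where
  "essential_submodule R M E \<longleftrightarrow>
     right_submodule R M E \<and>
     (\<forall>X. right_submodule R M X \<and> X \<noteq> {\<zero>\<^bsub>M\<^esub>} \<longrightarrow> E \<inter> X \<noteq> {\<zero>\<^bsub>M\<^esub>})"

definition annihilator ::
  "('a, 'm) ring_scheme \<Rightarrow> ('a, 'b) rmodule \<Rightarrow> 'b \<Rightarrow> 'a set" where
  "annihilator R M m = {r \<in> carrier R. m \<cdot>\<^bsub>M\<^esub> r = \<zero>\<^bsub>M\<^esub>}"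

definition singular_module :: "('a, 'm) ring_scheme \<Rightarrow> ('a, 'b) rmodule \<Rightarrow> bool" where
  "singular_module R M \<longleftrightarrow>
     (\<forall>m\<in>carrier M. essential_submodule R (regular_module R) (annihilator R M m))"

definition delta_small ::
  "('a, 'm) ring_scheme \<Rightarrow> ('a, 'b) rmodule \<Rightarrow> 'b set \<Rightarrow> bool" where
  "delta_small R M N \<longleftrightarrow>
     right_submodule R M N \<and>
     (\<forall>X. right_submodule R M X \<and> carrier M = N <+>\<^bsub>M\<^esub> X \<and> singular_module R (quot_module M X)
        \<longrightarrow> carrier M = X)"


section \<open>Projective modules and projective \<open>\<delta>\<close>-covers\<close>

text \<open>HOL cannot quantify over types inside a definition, so the modules in the next two
  definitions are taken from fixed types that are large enough for this to be no restriction: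
  \<open>'p \<Rightarrow> 'a\<close> has room for the free module on the elements of \<open>P\<close>, and \<open>'l \<Rightarrow> 'a\<close> has room for
  the free module on the elements of \<open>L\<close> and all its submodules. Lemmas \<open>projective_lift\<close> and
  \<open>has_projective_delta_coverI\<close> below show that both notions agree with the ones in which the
  modules may have elements of arbitrary types.\<close>

definition projective_module :: "('a, 'm) ring_scheme \<Rightarrow> ('a, 'p) rmodule \<Rightarrow> bool" where
  "projective_module R P \<longleftrightarrow>
     right_module R P \<and>
     (\<forall>(M :: ('a, 'p \<Rightarrow> 'a) rmodule) (N :: ('a, 'p) rmodule).
        right_module R M \<and> right_module R N \<longrightarrow>
        (\<forall>g\<in>rmodule_epi R M N. \<forall>f\<in>rmodule_hom R P N.
           \<exists>h\<in>rmodule_hom R P M. \<forall>x\<in>carrier P. g (h x) = f x))"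

definition projective_delta_cover ::
  "('a, 'm) ring_scheme \<Rightarrow> ('a, 'p) rmodule \<Rightarrow> ('p \<Rightarrow> 'l) \<Rightarrow> ('a, 'l) rmodule \<Rightarrow> bool" where
  "projective_delta_cover R P f L \<longleftrightarrow>
     projective_module R P \<and> f \<in> rmodule_epi R P L \<and> delta_small R P (a_kernel P L f)"

definition has_projective_delta_cover ::
  "('a, 'm) ring_scheme \<Rightarrow> ('a, 'l) rmodule \<Rightarrow> bool" where
  "has_projective_delta_cover R L \<longleftrightarrow>
     (\<exists>(P :: ('a, 'l \<Rightarrow> 'a) rmodule) f. projective_delta_cover R P f L)"


section \<open>The three properties\<close>

definition principally_delta_lifting ::
  "('a, 'm) ring_scheme \<Rightarrow> ('a, 'b) rmodule \<Rightarrow> bool" where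
  "principally_delta_lifting R M \<longleftrightarrow>
     (\<forall>m\<in>carrier M. \<exists>A B. direct_decomposition R M A B \<and>
        A \<subseteq> principal_submodule R M m \<and>
        delta_small R (M\<lparr>carrier := B\<rparr>) (principal_submodule R M m \<inter> B))"

definition principally_delta_semiperfect ::
  "('a, 'm) ring_scheme \<Rightarrow> ('a, 'b) rmodule \<Rightarrow> bool" where
  "principally_delta_semiperfect R M \<longleftrightarrow>
     (\<forall>m\<in>carrier M. has_projective_delta_cover R (quot_module M (principal_submodule R M m)))"

definition cyclically_presented :: "('a, 'm) ring_scheme \<Rightarrow> ('a, 'l) rmodule \<Rightarrow> bool" where
  "cyclically_presented R L \<longleftrightarrow>
     right_module R L \<and>
     (\<exists>a\<in>carrier R. rmodule_isomorphic R L
        (quot_module (regular_module R) (principal_submodule R (regular_module R) a)))"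

definition principally_delta_lifting_ring :: "('a, 'm) ring_scheme \<Rightarrow> bool" where
  "principally_delta_lifting_ring R \<longleftrightarrow> principally_delta_lifting R (regular_module R)"

definition principally_delta_semiperfect_ring :: "('a, 'm) ring_scheme \<Rightarrow> bool" where
  "principally_delta_semiperfect_ring R \<longleftrightarrow> principally_delta_semiperfect R (regular_module R)"

text \<open>The modules \<open>L\<close> range over the type \<open>'a set\<close> of the quotients \<open>R/aR\<close> themselves; lemma
  \<open>delta_semiregular_cover\<close> below extends the property to arbitrary types.\<close>

definition delta_semiregular_ring :: "('a, 'm) ring_scheme \<Rightarrow> bool" where
  "delta_semiregular_ring R \<longleftrightarrow>
     (\<forall>L :: ('a, 'a set) rmodule. cyclically_presented R L \<longrightarrow> has_projective_delta_cover R L)"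


section \<open>Elementary facts on right modules\<close>

context right_module
begin

lemma ract_zero [simp]: "x \<in> carrier M \<Longrightarrow> x \<cdot>\<^bsub>M\<^esub> \<zero>\<^bsub>R\<^esub> = \<zero>\<^bsub>M\<^esub>"
proof -
  assume x: "x \<in> carrier M"
  have "x \<cdot>\<^bsub>M\<^esub> \<zero>\<^bsub>R\<^esub> \<oplus>\<^bsub>M\<^esub> x \<cdot>\<^bsub>M\<^esub> \<zero>\<^bsub>R\<^esub> = x \<cdot>\<^bsub>M\<^esub> \<zero>\<^bsub>R\<^esub>"
    using ract_r_distr[of x "\<zero>\<^bsub>R\<^esub>" "\<zero>\<^bsub>R\<^esub>"] x by simp
  then show ?thesis using x by simp
qed

lemma zero_ract [simp]: "r \<in> carrier R \<Longrightarrow> \<zero>\<^bsub>M\<^esub> \<cdot>\<^bsub>M\<^esub> r = \<zero>\<^bsub>M\<^esub>"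
proof -
  assume r: "r \<in> carrier R"
  have "\<zero>\<^bsub>M\<^esub> \<cdot>\<^bsub>M\<^esub> r \<oplus>\<^bsub>M\<^esub> \<zero>\<^bsub>M\<^esub> \<cdot>\<^bsub>M\<^esub> r = \<zero>\<^bsub>M\<^esub> \<cdot>\<^bsub>M\<^esub> r"
    using ract_l_distr[of "\<zero>\<^bsub>M\<^esub>" "\<zero>\<^bsub>M\<^esub>" r] r by simp
  then show ?thesis using r by simp
qed

lemma ract_minus_one: "x \<in> carrier M \<Longrightarrow> x \<cdot>\<^bsub>M\<^esub> (\<ominus>\<^bsub>R\<^esub> \<one>\<^bsub>R\<^esub>) = \<ominus>\<^bsub>M\<^esub> x"
proof -
  assume x: "x \<in> carrier M"
  have "x \<oplus>\<^bsub>M\<^esub> x \<cdot>\<^bsub>M\<^esub> (\<ominus>\<^bsub>R\<^esub> \<one>\<^bsub>R\<^esub>) = \<zero>\<^bsub>M\<^esub>"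
    using ract_r_distr[of x "\<one>\<^bsub>R\<^esub>" "\<ominus>\<^bsub>R\<^esub> \<one>\<^bsub>R\<^esub>"] x by (simp add: R.r_neg)
  then show ?thesis using x by (metis M.minus_equality M.a_comm R.a_inv_closed R.one_closed ract_closed)
qed

lemma right_submodule_iff:
  "right_submodule R M N \<longleftrightarrow>
     N \<subseteq> carrier M \<and> \<zero>\<^bsub>M\<^esub> \<in> N \<and> (\<forall>x\<in>N. \<forall>y\<in>N. x \<oplus>\<^bsub>M\<^esub> y \<in> N) \<and>
     (\<forall>x\<in>N. \<forall>r\<in>carrier R. x \<cdot>\<^bsub>M\<^esub> r \<in> N)"
proof
  assume "right_submodule R M N"
  then interpret additive_subgroup N M by (simp add: right_submodule_def)
  show "N \<subseteq> carrier M \<and> \<zero>\<^bsub>M\<^esub> \<in> N \<and> (\<forall>x\<in>N. \<forall>y\<in>N. x \<oplus>\<^bsub>M\<^esub> y \<in> N) \<and>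
     (\<forall>x\<in>N. \<forall>r\<in>carrier R. x \<cdot>\<^bsub>M\<^esub> r \<in> N)"
    using a_subset \<open>right_submodule R M N\<close> by (simp add: right_submodule_def)
next
  assume *: "N \<subseteq> carrier M \<and> \<zero>\<^bsub>M\<^esub> \<in> N \<and> (\<forall>x\<in>N. \<forall>y\<in>N. x \<oplus>\<^bsub>M\<^esub> y \<in> N) \<and>
     (\<forall>x\<in>N. \<forall>r\<in>carrier R. x \<cdot>\<^bsub>M\<^esub> r \<in> N)"
  have "\<ominus>\<^bsub>M\<^esub> x \<in> N" if "x \<in> N" for x
    using * that ract_minus_one[of x] by (metis R.a_inv_closed R.one_closed subsetD)
  then have "subgroup N (add_monoid M)"
    using * by (intro M.add.subgroupI) auto
  then show "right_submodule R M N"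
    using * by (simp add: right_submodule_def additive_subgroup.intro)
qed

lemma submodule_minus:
  assumes "right_submodule R M N" "x \<in> N" "y \<in> N" shows "x \<ominus>\<^bsub>M\<^esub> y \<in> N"
proof -
  interpret additive_subgroup N M using assms by (simp add: right_submodule_def)
  show ?thesis using assms by (simp add: a_minus_def)
qed

lemma mem_set_add: "z \<in> A <+>\<^bsub>M\<^esub> B \<longleftrightarrow> (\<exists>a\<in>A. \<exists>b\<in>B. z = a \<oplus>\<^bsub>M\<^esub> b)"
  by (auto simp: set_add_def')

lemma submodule_add:
  assumes A: "right_submodule R M A" and B: "right_submodule R M B"
  shows "right_submodule R M (A <+>\<^bsub>M\<^esub> B)"
proof -
  note A' = A[unfolded right_submodule_iff] and B' = B[unfolded right_submodule_iff]
  show ?thesis unfolding right_submodule_iff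
  proof (intro conjI ballI)
    show "A <+>\<^bsub>M\<^esub> B \<subseteq> carrier M" using A' B' by (intro M.setadd_subset_G) auto
    show "\<zero>\<^bsub>M\<^esub> \<in> A <+>\<^bsub>M\<^esub> B" using A' B' unfolding mem_set_add by (metis M.l_zero M.zero_closed)
    fix x assume "x \<in> A <+>\<^bsub>M\<^esub> B"
    then obtain a b where x: "a \<in> A" "b \<in> B" "x = a \<oplus>\<^bsub>M\<^esub> b" unfolding mem_set_add by blast
    { fix y assume "y \<in> A <+>\<^bsub>M\<^esub> B"
      then obtain c d where y: "c \<in> A" "d \<in> B" "y = c \<oplus>\<^bsub>M\<^esub> d" unfolding mem_set_add by blast
      have "x \<oplus>\<^bsub>M\<^esub> y = (a \<oplus>\<^bsub>M\<^esub> c) \<oplus>\<^bsub>M\<^esub> (b \<oplus>\<^bsub>M\<^esub> d)"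
        using x y A' B' by (simp add: M.a_ac subset_iff)
      then show "x \<oplus>\<^bsub>M\<^esub> y \<in> A <+>\<^bsub>M\<^esub> B" unfolding mem_set_add using x y A' B' by blast }
    fix r assume "r \<in> carrier R"
    then show "x \<cdot>\<^bsub>M\<^esub> r \<in> A <+>\<^bsub>M\<^esub> B"
      unfolding mem_set_add using x A' B' ract_l_distr[of a b r] by blast
  qed
qed

lemma submodule_right_module:
  assumes "right_submodule R M N" shows "right_module R (M\<lparr>carrier := N\<rparr>)"
proof -
  note N = assms[unfolded right_submodule_iff]
  have "abelian_group (M\<lparr>carrier := N\<rparr>)"
  proof (rule abelian_groupI)
    fix x assume "x \<in> carrier (M\<lparr>carrier := N\<rparr>)"
    then have x: "x \<in> N" "x \<in> carrier M" using N by auto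
    then have "x \<cdot>\<^bsub>M\<^esub> (\<ominus>\<^bsub>R\<^esub> \<one>\<^bsub>R\<^esub>) \<in> N" using N by blast
    then have "\<ominus>\<^bsub>M\<^esub> x \<in> N" using x by (simp add: ract_minus_one)
    then show "\<exists>y\<in>carrier (M\<lparr>carrier := N\<rparr>). y \<oplus>\<^bsub>M\<lparr>carrier := N\<rparr>\<^esub> x = \<zero>\<^bsub>M\<lparr>carrier := N\<rparr>\<^esub>"
      using x by (intro bexI[of _ "\<ominus>\<^bsub>M\<^esub> x"]) (simp_all add: M.l_neg)
  qed (use N in \<open>auto simp: subset_iff M.a_ac\<close>)
  then show ?thesis
    by (intro right_module.intro R.ring_axioms right_module_axioms.intro)
       (use N in \<open>auto simp: subset_iff ract_l_distr ract_r_distr ract_assoc\<close>)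
qed

lemma submodule_submodule:
  assumes "right_submodule R M N"
  shows "right_submodule R (M\<lparr>carrier := N\<rparr>) X \<longleftrightarrow> right_submodule R M X \<and> X \<subseteq> N"
proof -
  interpret N: right_module R "M\<lparr>carrier := N\<rparr>" using assms by (rule submodule_right_module)
  show ?thesis using assms unfolding right_submodule_iff N.right_submodule_iff by auto
qed

lemma principal_right_submodule:
  assumes "m \<in> carrier M" shows "right_submodule R M (principal_submodule R M m)"
  unfolding right_submodule_iff principal_submodule_def
proof (intro conjI ballI)
  show "\<zero>\<^bsub>M\<^esub> \<in> (\<lambda>r. m \<cdot>\<^bsub>M\<^esub> r) ` carrier R" using assms by (auto intro!: image_eqI[of _ _ "\<zero>\<^bsub>R\<^esub>"])
next
  fix x assume "x \<in> (\<lambda>r. m \<cdot>\<^bsub>M\<^esub> r) ` carrier R"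
  then obtain r where r: "r \<in> carrier R" "x = m \<cdot>\<^bsub>M\<^esub> r" by blast
  { fix y assume "y \<in> (\<lambda>r. m \<cdot>\<^bsub>M\<^esub> r) ` carrier R"
    then obtain s where s: "s \<in> carrier R" "y = m \<cdot>\<^bsub>M\<^esub> s" by blast
    then have "x \<oplus>\<^bsub>M\<^esub> y = m \<cdot>\<^bsub>M\<^esub> (r \<oplus>\<^bsub>R\<^esub> s)" using r assms by (simp add: ract_r_distr)
    then show "x \<oplus>\<^bsub>M\<^esub> y \<in> (\<lambda>r. m \<cdot>\<^bsub>M\<^esub> r) ` carrier R" using r s by blast }
  fix s assume s: "s \<in> carrier R"
  then have "x \<cdot>\<^bsub>M\<^esub> s = m \<cdot>\<^bsub>M\<^esub> (r \<otimes>\<^bsub>R\<^esub> s)" using r assms by (simp add: ract_assoc)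
  then show "x \<cdot>\<^bsub>M\<^esub> s \<in> (\<lambda>r. m \<cdot>\<^bsub>M\<^esub> r) ` carrier R" using r s by blast
qed (use assms in auto)

lemma abelian_subgroup_submodule:
  assumes "right_submodule R M X" shows "abelian_subgroup X M"
  using assms M.abelian_group_axioms by (simp add: right_submodule_def abelian_subgroupI3)

lemma coset_eq_iff:
  assumes X: "right_submodule R M X" and x: "x \<in> carrier M" and y: "y \<in> carrier M"
  shows "X +>\<^bsub>M\<^esub> x = X +>\<^bsub>M\<^esub> y \<longleftrightarrow> x \<ominus>\<^bsub>M\<^esub> y \<in> X"
proof -
  interpret X: abelian_subgroup X M using X by (rule abelian_subgroup_submodule)
  have d: "x \<ominus>\<^bsub>M\<^esub> y \<in> carrier M" using x y by simp
  show ?thesis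
  proof
    assume "X +>\<^bsub>M\<^esub> x = X +>\<^bsub>M\<^esub> y"
    then have "X +>\<^bsub>M\<^esub> (x \<ominus>\<^bsub>M\<^esub> y) = X"
      using M.a_coset_add_inv2[of X x y] X.a_subset x y by (simp add: a_minus_def)
    then show "x \<ominus>\<^bsub>M\<^esub> y \<in> X" by (rule M.a_coset_join1[OF _ d X.a_subgroup])
  next
    assume "x \<ominus>\<^bsub>M\<^esub> y \<in> X"
    then have "X +>\<^bsub>M\<^esub> (x \<ominus>\<^bsub>M\<^esub> y) = X" by (rule M.a_coset_join2[OF d X.a_subgroup])
    then show "X +>\<^bsub>M\<^esub> x = X +>\<^bsub>M\<^esub> y"
      using M.a_coset_add_inv1[of X x y] X.a_subset x y by (simp add: a_minus_def)
  qed
qed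

lemma ract_coset:
  assumes X: "right_submodule R M X" and x: "x \<in> carrier M" and r: "r \<in> carrier R"
  shows "(X +>\<^bsub>M\<^esub> x) \<cdot>\<^bsub>quot_module M X\<^esub> r = X +>\<^bsub>M\<^esub> (x \<cdot>\<^bsub>M\<^esub> r)"
proof -
  interpret X: abelian_subgroup X M using X by (rule abelian_subgroup_submodule)
  have "X +>\<^bsub>M\<^esub> (y \<cdot>\<^bsub>M\<^esub> r) = X +>\<^bsub>M\<^esub> (x \<cdot>\<^bsub>M\<^esub> r)" if y: "y \<in> X +>\<^bsub>M\<^esub> x" for y
  proof -
    have yM: "y \<in> carrier M" using y x X.a_subset M.a_r_coset_subset_G by blast
    obtain h where h: "h \<in> X" "y = h \<oplus>\<^bsub>M\<^esub> x" using y by (auto simp: a_r_coset_def')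
    have hM: "h \<in> carrier M" using h X.a_subset by blast
    have "y \<cdot>\<^bsub>M\<^esub> r \<ominus>\<^bsub>M\<^esub> x \<cdot>\<^bsub>M\<^esub> r = h \<cdot>\<^bsub>M\<^esub> r"
      using h hM x r by (simp add: ract_l_distr a_minus_def M.a_assoc M.r_neg)
    moreover have "h \<cdot>\<^bsub>M\<^esub> r \<in> X" using X h r by (simp add: right_submodule_iff)
    ultimately show ?thesis using coset_eq_iff[OF X, of "y \<cdot>\<^bsub>M\<^esub> r" "x \<cdot>\<^bsub>M\<^esub> r"] x yM r by simp
  qed
  moreover have "x \<in> X +>\<^bsub>M\<^esub> x" using x by (rule X.a_rcos_self)
  ultimately have "(\<Union>y\<in>X +>\<^bsub>M\<^esub> x. X +>\<^bsub>M\<^esub> (y \<cdot>\<^bsub>M\<^esub> r)) = X +>\<^bsub>M\<^esub> (x \<cdot>\<^bsub>M\<^esub> r)" by blast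
  then show ?thesis by (simp only: quot_module_def rmodule.select_convs)
qed

lemma quot_right_module:
  assumes X: "right_submodule R M X" shows "right_module R (quot_module M X)"
proof -
  interpret X: abelian_subgroup X M using X by (rule abelian_subgroup_submodule)
  let ?Q = "quot_module M X"
  have carr: "C \<in> carrier ?Q \<longleftrightarrow> (\<exists>x\<in>carrier M. C = X +>\<^bsub>M\<^esub> x)" for C
    by (auto simp: quot_module_def A_RCOSETS_def')
  have add: "(X +>\<^bsub>M\<^esub> x) \<oplus>\<^bsub>?Q\<^esub> (X +>\<^bsub>M\<^esub> y) = X +>\<^bsub>M\<^esub> (x \<oplus>\<^bsub>M\<^esub> y)"
    if "x \<in> carrier M" "y \<in> carrier M" for x y
    using that by (simp add: quot_module_def X.a_rcos_sum)
  have zero: "\<zero>\<^bsub>?Q\<^esub> = X +>\<^bsub>M\<^esub> \<zero>\<^bsub>M\<^esub>" using X.a_subset by (simp add: quot_module_def)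
  have "abelian_group ?Q"
  proof (rule abelian_groupI)
    fix C assume "C \<in> carrier ?Q"
    then obtain x where x: "x \<in> carrier M" "C = X +>\<^bsub>M\<^esub> x" unfolding carr by blast
    show "\<exists>D\<in>carrier ?Q. D \<oplus>\<^bsub>?Q\<^esub> C = \<zero>\<^bsub>?Q\<^esub>"
    proof
      show "X +>\<^bsub>M\<^esub> (\<ominus>\<^bsub>M\<^esub> x) \<in> carrier ?Q" unfolding carr using x by blast
      show "(X +>\<^bsub>M\<^esub> (\<ominus>\<^bsub>M\<^esub> x)) \<oplus>\<^bsub>?Q\<^esub> C = \<zero>\<^bsub>?Q\<^esub>"
        unfolding zero using x by (simp add: add M.l_neg)
    qed
  next
    fix C D assume "C \<in> carrier ?Q" "D \<in> carrier ?Q"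
    then obtain x y where "x \<in> carrier M" "C = X +>\<^bsub>M\<^esub> x" "y \<in> carrier M" "D = X +>\<^bsub>M\<^esub> y"
      unfolding carr by blast
    then show "C \<oplus>\<^bsub>?Q\<^esub> D \<in> carrier ?Q" "C \<oplus>\<^bsub>?Q\<^esub> D = D \<oplus>\<^bsub>?Q\<^esub> C"
      by (auto simp: add carr M.a_comm intro: M.a_closed)
  next
    fix C D E assume "C \<in> carrier ?Q" "D \<in> carrier ?Q" "E \<in> carrier ?Q"
    then obtain x y z where "x \<in> carrier M" "C = X +>\<^bsub>M\<^esub> x" "y \<in> carrier M" "D = X +>\<^bsub>M\<^esub> y"
      "z \<in> carrier M" "E = X +>\<^bsub>M\<^esub> z"
      unfolding carr by blast
    then show "(C \<oplus>\<^bsub>?Q\<^esub> D) \<oplus>\<^bsub>?Q\<^esub> E = C \<oplus>\<^bsub>?Q\<^esub> (D \<oplus>\<^bsub>?Q\<^esub> E)"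
      by (auto simp: add M.a_assoc)
  next
    show "\<zero>\<^bsub>?Q\<^esub> \<in> carrier ?Q" unfolding zero carr by blast
  next
    fix C assume "C \<in> carrier ?Q"
    then show "\<zero>\<^bsub>?Q\<^esub> \<oplus>\<^bsub>?Q\<^esub> C = C" unfolding zero carr by (auto simp: add)
  qed
  moreover have "right_module_axioms R ?Q"
  proof
    fix C r assume C: "C \<in> carrier ?Q" and r: "r \<in> carrier R"
    then obtain x where x: "x \<in> carrier M" "C = X +>\<^bsub>M\<^esub> x" unfolding carr by blast
    show "C \<cdot>\<^bsub>?Q\<^esub> r \<in> carrier ?Q" using x r by (auto simp: ract_coset[OF X] carr)
    { fix D assume "D \<in> carrier ?Q"
      then obtain y where y: "y \<in> carrier M" "D = X +>\<^bsub>M\<^esub> y" unfolding carr by blast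
      show "(C \<oplus>\<^bsub>?Q\<^esub> D) \<cdot>\<^bsub>?Q\<^esub> r = C \<cdot>\<^bsub>?Q\<^esub> r \<oplus>\<^bsub>?Q\<^esub> D \<cdot>\<^bsub>?Q\<^esub> r"
        using x y r by (simp add: add ract_coset[OF X] ract_l_distr) }
    fix s assume s: "s \<in> carrier R"
    show "C \<cdot>\<^bsub>?Q\<^esub> (r \<oplus>\<^bsub>R\<^esub> s) = C \<cdot>\<^bsub>?Q\<^esub> r \<oplus>\<^bsub>?Q\<^esub> C \<cdot>\<^bsub>?Q\<^esub> s"
      using x r s by (simp add: add ract_coset[OF X] ract_r_distr)
    show "C \<cdot>\<^bsub>?Q\<^esub> (r \<otimes>\<^bsub>R\<^esub> s) = C \<cdot>\<^bsub>?Q\<^esub> r \<cdot>\<^bsub>?Q\<^esub> s"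
      using x r s by (simp add: ract_coset[OF X] ract_assoc)
  next
    fix C assume "C \<in> carrier ?Q"
    then obtain x where x: "x \<in> carrier M" "C = X +>\<^bsub>M\<^esub> x" unfolding carr by blast
    then show "C \<cdot>\<^bsub>?Q\<^esub> \<one>\<^bsub>R\<^esub> = C" by (simp add: ract_coset[OF X])
  qed
  ultimately show ?thesis by (simp add: right_module_def R.ring_axioms)
qed

lemma annihilator_coset:
  assumes X: "right_submodule R M X" and x: "x \<in> carrier M"
  shows "annihilator R (quot_module M X) (X +>\<^bsub>M\<^esub> x) = {r \<in> carrier R. x \<cdot>\<^bsub>M\<^esub> r \<in> X}"
proof -
  interpret X: abelian_subgroup X M using X by (rule abelian_subgroup_submodule)
  have "X +>\<^bsub>M\<^esub> (x \<cdot>\<^bsub>M\<^esub> r) = X \<longleftrightarrow> x \<cdot>\<^bsub>M\<^esub> r \<in> X" if "r \<in> carrier R" for r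
    using that x X.a_subgroup M.a_coset_join1 M.a_coset_join2 by (metis ract_closed)
  then show ?thesis using x
    by (auto simp: annihilator_def ract_coset[OF X])
       (auto simp: quot_module_def)
qed

lemma singular_quot_iff:
  assumes X: "right_submodule R M X"
  shows "singular_module R (quot_module M X) \<longleftrightarrow>
    (\<forall>x\<in>carrier M. essential_submodule R (regular_module R) {r \<in> carrier R. x \<cdot>\<^bsub>M\<^esub> r \<in> X})"
proof -
  have "carrier (quot_module M X) = (\<lambda>x. X +>\<^bsub>M\<^esub> x) ` carrier M"
    by (auto simp: quot_module_def A_RCOSETS_def')
  then show ?thesis by (simp add: singular_module_def annihilator_coset[OF X])
qed

end

lemma (in ring) right_module_regular: "right_module R (regular_module R)"
proof -
  have "abelian_group (regular_module R)"
  proof (rule abelian_groupI)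
    fix x assume "x \<in> carrier (regular_module R)"
    then show "\<exists>y\<in>carrier (regular_module R). y \<oplus>\<^bsub>regular_module R\<^esub> x = \<zero>\<^bsub>regular_module R\<^esub>"
      by (auto simp: regular_module_def intro!: bexI[of _ "\<ominus> x"] l_neg)
  qed (auto simp: regular_module_def a_ac)
  then show ?thesis
    by (intro right_module.intro ring_axioms right_module_axioms.intro)
       (auto simp: regular_module_def m_assoc l_distr r_distr)
qed

lemma rmodule_homD:
  assumes "f \<in> rmodule_hom R M N"
  shows "x \<in> carrier M \<Longrightarrow> f x \<in> carrier N"
    and "x \<in> carrier M \<Longrightarrow> y \<in> carrier M \<Longrightarrow> f (x \<oplus>\<^bsub>M\<^esub> y) = f x \<oplus>\<^bsub>N\<^esub> f y"
    and "x \<in> carrier M \<Longrightarrow> r \<in> carrier R \<Longrightarrow> f (x \<cdot>\<^bsub>M\<^esub> r) = f x \<cdot>\<^bsub>N\<^esub> r"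
  using assms by (auto simp: rmodule_hom_def)

lemma rmodule_hom_zero:
  assumes "right_module R M" "right_module R N" "f \<in> rmodule_hom R M N"
  shows "f \<zero>\<^bsub>M\<^esub> = \<zero>\<^bsub>N\<^esub>"
proof -
  interpret M: right_module R M by fact
  interpret N: right_module R N by fact
  have "f (\<zero>\<^bsub>M\<^esub> \<cdot>\<^bsub>M\<^esub> \<zero>\<^bsub>R\<^esub>) = f \<zero>\<^bsub>M\<^esub> \<cdot>\<^bsub>N\<^esub> \<zero>\<^bsub>R\<^esub>"
    by (rule rmodule_homD(3)[OF assms(3)]) simp_all
  then show ?thesis using rmodule_homD(1)[OF assms(3), of "\<zero>\<^bsub>M\<^esub>"] by simp
qed

lemma rmodule_hom_comp:
  assumes "f \<in> rmodule_hom R M N" "g \<in> rmodule_hom R N P"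
  shows "(\<lambda>x. g (f x)) \<in> rmodule_hom R M P"
  using assms by (auto simp: rmodule_hom_def Pi_iff)

lemma rmodule_hom_image:
  assumes "right_module R M" "right_module R N" "f \<in> rmodule_hom R M N" "right_submodule R M X"
  shows "right_submodule R N (f ` X)"
proof -
  interpret M: right_module R M by fact
  interpret N: right_module R N by fact
  note X = assms(4)[unfolded M.right_submodule_iff]
  note f = rmodule_homD[OF assms(3)]
  show ?thesis unfolding N.right_submodule_iff
  proof (intro conjI ballI)
    show "f ` X \<subseteq> carrier N" using X f by auto
    show "\<zero>\<^bsub>N\<^esub> \<in> f ` X" using X rmodule_hom_zero[OF assms(1,2,3)] by force
    fix x assume "x \<in> f ` X"
    then obtain a where a: "a \<in> X" "x = f a" by blast
    then have aM: "a \<in> carrier M" using X by blast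
    { fix y assume "y \<in> f ` X"
      then obtain b where b: "b \<in> X" "y = f b" by blast
      then have "b \<in> carrier M" using X by blast
      then have "x \<oplus>\<^bsub>N\<^esub> y = f (a \<oplus>\<^bsub>M\<^esub> b)" using f a b aM by simp
      then show "x \<oplus>\<^bsub>N\<^esub> y \<in> f ` X" using X a b by blast }
    fix r assume "r \<in> carrier R"
    then have "x \<cdot>\<^bsub>N\<^esub> r = f (a \<cdot>\<^bsub>M\<^esub> r)" "a \<cdot>\<^bsub>M\<^esub> r \<in> X" using f a aM X by auto
    then show "x \<cdot>\<^bsub>N\<^esub> r \<in> f ` X" by blast
  qed
qed

lemma right_submodule_carrier:
  assumes "right_module R M" shows "right_submodule R M (carrier M)"
proof -
  interpret M: right_module R M by fact
  show ?thesis by (simp add: M.right_submodule_iff)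
qed

lemma rmodule_hom_kernel:
  assumes "right_module R M" "right_module R N" "f \<in> rmodule_hom R M N"
  shows "right_submodule R M (a_kernel M N f)"
proof -
  interpret M: right_module R M by fact
  interpret N: right_module R N by fact
  note f = rmodule_homD[OF assms(3)]
  show ?thesis
    unfolding M.right_submodule_iff a_kernel_def' using f rmodule_hom_zero[OF assms] by auto
qed


section \<open>Projectivity and modules of arbitrary types\<close>

definition free_module :: "('a, 'm) ring_scheme \<Rightarrow> 'i set \<Rightarrow> ('a, 'i \<Rightarrow> 'a) rmodule" where
  "free_module R I =
     \<lparr>carrier = {\<phi>. (\<forall>i. \<phi> i \<in> carrier R) \<and> (\<forall>i. i \<notin> I \<longrightarrow> \<phi> i = \<zero>\<^bsub>R\<^esub>) \<and> finite {i. \<phi> i \<noteq> \<zero>\<^bsub>R\<^esub>}},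
      mult = (\<lambda>_ _ _. \<zero>\<^bsub>R\<^esub>), one = (\<lambda>_. \<zero>\<^bsub>R\<^esub>), zero = (\<lambda>_. \<zero>\<^bsub>R\<^esub>),
      add = (\<lambda>\<phi> \<psi> i. \<phi> i \<oplus>\<^bsub>R\<^esub> \<psi> i), ract = (\<lambda>\<phi> r i. \<phi> i \<otimes>\<^bsub>R\<^esub> r)\<rparr>"

definition free_lift :: "('a, 'm) ring_scheme \<Rightarrow> ('a, 'b) rmodule \<Rightarrow> ('i \<Rightarrow> 'b) \<Rightarrow> ('i \<Rightarrow> 'a) \<Rightarrow> 'b" where
  "free_lift R M u \<phi> = finsum M (\<lambda>i. u i \<cdot>\<^bsub>M\<^esub> \<phi> i) {i. \<phi> i \<noteq> \<zero>\<^bsub>R\<^esub>}"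

definition free_basis :: "('a, 'm) ring_scheme \<Rightarrow> 'i \<Rightarrow> 'i \<Rightarrow> 'a" where
  "free_basis R i j = (if j = i then \<one>\<^bsub>R\<^esub> else \<zero>\<^bsub>R\<^esub>)"

lemma (in ring) free_right_module: "right_module R (free_module R I)"
proof -
  have add: "finite {i. \<phi> i \<oplus> \<psi> i \<noteq> \<zero>}"
    if "finite {i. \<phi> i \<noteq> \<zero>}" "finite {i. \<psi> i \<noteq> \<zero>}" for \<phi> \<psi> :: "'i \<Rightarrow> 'a"
    by (rule finite_subset[of _ "{i. \<phi> i \<noteq> \<zero>} \<union> {i. \<psi> i \<noteq> \<zero>}"]) (use that in auto)
  have mul: "finite {i. \<phi> i \<otimes> r \<noteq> \<zero>}"
    if "finite {i. \<phi> i \<noteq> \<zero>}" "r \<in> carrier R" for \<phi> :: "'i \<Rightarrow> 'a" and r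
    by (rule finite_subset[of _ "{i. \<phi> i \<noteq> \<zero>}"]) (use that in auto)
  have "abelian_group (free_module R I)"
  proof (rule abelian_groupI)
    fix \<phi> assume phi: "\<phi> \<in> carrier (free_module R I)"
    then have "{i. \<ominus> \<phi> i \<noteq> \<zero>} = {i. \<phi> i \<noteq> \<zero>}"
      by (auto simp: free_module_def)
    with phi show "\<exists>\<psi>\<in>carrier (free_module R I).
        \<psi> \<oplus>\<^bsub>free_module R I\<^esub> \<phi> = \<zero>\<^bsub>free_module R I\<^esub>"
      by (intro bexI[of _ "\<lambda>i. \<ominus> \<phi> i"]) (auto simp: free_module_def l_neg)
  qed (auto simp: free_module_def add a_ac)
  then show ?thesis
    by (intro right_module.intro ring_axioms right_module_axioms.intro)
       (auto simp: free_module_def mul l_distr r_distr m_assoc)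
qed

lemma (in ring) free_basis_carrier:
  "i \<in> I \<Longrightarrow> free_basis R i \<in> carrier (free_module R I)"
  by (auto simp: free_module_def free_basis_def)

lemma hom_finsum:
  assumes "abelian_group M" "abelian_group N" "f \<in> carrier M \<rightarrow> carrier N"
    "f \<zero>\<^bsub>M\<^esub> = \<zero>\<^bsub>N\<^esub>"
    "\<And>x y. x \<in> carrier M \<Longrightarrow> y \<in> carrier M \<Longrightarrow> f (x \<oplus>\<^bsub>M\<^esub> y) = f x \<oplus>\<^bsub>N\<^esub> f y"
    "finite A" "v \<in> A \<rightarrow> carrier M"
  shows "f (finsum M v A) = finsum N (\<lambda>i. f (v i)) A"
proof -
  interpret M: abelian_group M by fact
  interpret N: abelian_group N by fact
  show ?thesis using assms(6,7)
  proof (induction A rule: finite_induct)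
    case empty
    then show ?case using assms(4) by simp
  next
    case (insert a A)
    have v: "v a \<in> carrier M" "v \<in> A \<rightarrow> carrier M" using insert.prems by auto
    have fv: "f (v a) \<in> carrier N" "(\<lambda>i. f (v i)) \<in> A \<rightarrow> carrier N" using v assms(3) by auto
    have "f (finsum M v (insert a A)) = f (v a \<oplus>\<^bsub>M\<^esub> finsum M v A)"
      using insert.hyps v by (simp add: M.finsum_insert)
    also have "\<dots> = f (v a) \<oplus>\<^bsub>N\<^esub> f (finsum M v A)"
      using v by (intro assms(5)) auto
    also have "\<dots> = f (v a) \<oplus>\<^bsub>N\<^esub> finsum N (\<lambda>i. f (v i)) A"
      using insert.IH v by simp
    also have "\<dots> = finsum N (\<lambda>i. f (v i)) (insert a A)"
      using insert.hyps fv by (simp add: N.finsum_insert)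
    finally show ?case .
  qed
qed

context right_module
begin

lemma free_lift_superset:
  assumes u: "u \<in> I \<rightarrow> carrier M" and phi: "\<phi> \<in> carrier (free_module R I)"
    and A: "finite A" "{i. \<phi> i \<noteq> \<zero>\<^bsub>R\<^esub>} \<subseteq> A" "A \<subseteq> I"
  shows "free_lift R M u \<phi> = finsum M (\<lambda>i. u i \<cdot>\<^bsub>M\<^esub> \<phi> i) A"
  unfolding free_lift_def
proof (rule M.add.finprod_mono_neutral_cong_left[OF A(1,2)])
  have "\<phi> i \<in> carrier R" for i using phi by (simp add: free_module_def)
  then show "(\<lambda>i. u i \<cdot>\<^bsub>M\<^esub> \<phi> i) \<in> A \<rightarrow> carrier M" using u A(3) by auto
  fix i assume i: "i \<in> A - {i. \<phi> i \<noteq> \<zero>\<^bsub>R\<^esub>}"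
  then have "u i \<in> carrier M" using u A(3) by blast
  with i show "u i \<cdot>\<^bsub>M\<^esub> \<phi> i = \<zero>\<^bsub>M\<^esub>" by simp
qed auto

lemma free_lift_hom:
  assumes u: "u \<in> I \<rightarrow> carrier M"
  shows "free_lift R M u \<in> rmodule_hom R (free_module R I) M"
proof -
  let ?F = "free_module R I"
  have c: "\<phi> i \<in> carrier R" if "\<phi> \<in> carrier ?F" for \<phi> i using that by (simp add: free_module_def)
  have s: "finite {i. \<phi> i \<noteq> \<zero>\<^bsub>R\<^esub>}" "{i. \<phi> i \<noteq> \<zero>\<^bsub>R\<^esub>} \<subseteq> I" if "\<phi> \<in> carrier ?F" for \<phi>
    using that by (auto simp: free_module_def)
  have t: "(\<lambda>i. u i \<cdot>\<^bsub>M\<^esub> \<phi> i) \<in> A \<rightarrow> carrier M" if "\<phi> \<in> carrier ?F" "A \<subseteq> I" for \<phi> A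
    using c[OF that(1)] u that(2) by auto
  interpret F: right_module R ?F by (rule R.free_right_module)
  have "free_lift R M u \<phi> \<in> carrier M" if "\<phi> \<in> carrier ?F" for \<phi>
    unfolding free_lift_def using t[OF that s(2)[OF that]] by (rule M.finsum_closed)
  moreover have "free_lift R M u (\<phi> \<oplus>\<^bsub>?F\<^esub> \<psi>) = free_lift R M u \<phi> \<oplus>\<^bsub>M\<^esub> free_lift R M u \<psi>"
    if p: "\<phi> \<in> carrier ?F" "\<psi> \<in> carrier ?F" for \<phi> \<psi>
  proof -
    define A where "A = {i. \<phi> i \<noteq> \<zero>\<^bsub>R\<^esub>} \<union> {i. \<psi> i \<noteq> \<zero>\<^bsub>R\<^esub>}"
    have A: "finite A" "A \<subseteq> I" using s[OF p(1)] s[OF p(2)] by (auto simp: A_def)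
    have pp: "\<phi> \<oplus>\<^bsub>?F\<^esub> \<psi> \<in> carrier ?F" using p by simp
    have e: "(\<phi> \<oplus>\<^bsub>?F\<^esub> \<psi>) i = \<phi> i \<oplus>\<^bsub>R\<^esub> \<psi> i" for i by (simp add: free_module_def)
    have "{i. (\<phi> \<oplus>\<^bsub>?F\<^esub> \<psi>) i \<noteq> \<zero>\<^bsub>R\<^esub>} \<subseteq> A" by (auto simp: A_def e)
    then have "free_lift R M u (\<phi> \<oplus>\<^bsub>?F\<^esub> \<psi>) = finsum M (\<lambda>i. u i \<cdot>\<^bsub>M\<^esub> (\<phi> \<oplus>\<^bsub>?F\<^esub> \<psi>) i) A"
      by (intro free_lift_superset[OF u pp] A)
    also have "\<dots> = finsum M (\<lambda>i. u i \<cdot>\<^bsub>M\<^esub> \<phi> i \<oplus>\<^bsub>M\<^esub> u i \<cdot>\<^bsub>M\<^esub> \<psi> i) A"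
    proof (rule M.finsum_cong')
      show "(\<lambda>i. u i \<cdot>\<^bsub>M\<^esub> \<phi> i \<oplus>\<^bsub>M\<^esub> u i \<cdot>\<^bsub>M\<^esub> \<psi> i) \<in> A \<rightarrow> carrier M"
        using t[OF p(1) A(2)] t[OF p(2) A(2)] by auto
      fix i assume "i \<in> A"
      then have "u i \<in> carrier M" using u A by auto
      then show "u i \<cdot>\<^bsub>M\<^esub> (\<phi> \<oplus>\<^bsub>?F\<^esub> \<psi>) i = u i \<cdot>\<^bsub>M\<^esub> \<phi> i \<oplus>\<^bsub>M\<^esub> u i \<cdot>\<^bsub>M\<^esub> \<psi> i"
        unfolding e by (intro ract_r_distr c[OF p(1)] c[OF p(2)])
    qed simp
    also have "\<dots> = finsum M (\<lambda>i. u i \<cdot>\<^bsub>M\<^esub> \<phi> i) A \<oplus>\<^bsub>M\<^esub> finsum M (\<lambda>i. u i \<cdot>\<^bsub>M\<^esub> \<psi> i) A"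
      by (rule M.finsum_addf[OF t[OF p(1) A(2)] t[OF p(2) A(2)]])
    also have "finsum M (\<lambda>i. u i \<cdot>\<^bsub>M\<^esub> \<phi> i) A = free_lift R M u \<phi>"
      using free_lift_superset[OF u p(1) A(1) _ A(2)] by (simp add: A_def)
    also have "finsum M (\<lambda>i. u i \<cdot>\<^bsub>M\<^esub> \<psi> i) A = free_lift R M u \<psi>"
      using free_lift_superset[OF u p(2) A(1) _ A(2)] by (simp add: A_def)
    finally show ?thesis .
  qed
  moreover have "free_lift R M u (\<phi> \<cdot>\<^bsub>?F\<^esub> r) = free_lift R M u \<phi> \<cdot>\<^bsub>M\<^esub> r"
    if p: "\<phi> \<in> carrier ?F" and r: "r \<in> carrier R" for \<phi> r
  proof -
    define A where "A = {i. \<phi> i \<noteq> \<zero>\<^bsub>R\<^esub>}"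
    have A: "finite A" "A \<subseteq> I" using s[OF p] by (auto simp: A_def)
    have pr: "\<phi> \<cdot>\<^bsub>?F\<^esub> r \<in> carrier ?F" using p r by simp
    have e: "(\<phi> \<cdot>\<^bsub>?F\<^esub> r) i = \<phi> i \<otimes>\<^bsub>R\<^esub> r" for i by (simp add: free_module_def)
    have "{i. (\<phi> \<cdot>\<^bsub>?F\<^esub> r) i \<noteq> \<zero>\<^bsub>R\<^esub>} \<subseteq> A" using r by (auto simp: A_def e)
    then have "free_lift R M u (\<phi> \<cdot>\<^bsub>?F\<^esub> r) = finsum M (\<lambda>i. u i \<cdot>\<^bsub>M\<^esub> (\<phi> \<cdot>\<^bsub>?F\<^esub> r) i) A"
      by (intro free_lift_superset[OF u pr] A)
    also have "\<dots> = finsum M (\<lambda>i. (u i \<cdot>\<^bsub>M\<^esub> \<phi> i) \<cdot>\<^bsub>M\<^esub> r) A"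
    proof (rule M.finsum_cong')
      show "(\<lambda>i. (u i \<cdot>\<^bsub>M\<^esub> \<phi> i) \<cdot>\<^bsub>M\<^esub> r) \<in> A \<rightarrow> carrier M"
        using t[OF p A(2)] r by auto
      fix i assume "i \<in> A"
      then have "u i \<in> carrier M" using u A by auto
      then show "u i \<cdot>\<^bsub>M\<^esub> (\<phi> \<cdot>\<^bsub>?F\<^esub> r) i = (u i \<cdot>\<^bsub>M\<^esub> \<phi> i) \<cdot>\<^bsub>M\<^esub> r"
        unfolding e by (intro ract_assoc c[OF p] r)
    qed simp
    also have "\<dots> = finsum M (\<lambda>i. u i \<cdot>\<^bsub>M\<^esub> \<phi> i) A \<cdot>\<^bsub>M\<^esub> r"
      by (rule hom_finsum[OF M.abelian_group_axioms M.abelian_group_axioms, symmetric])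
         (use r A t[OF p A(2)] in \<open>simp_all add: ract_l_distr\<close>)
    finally show ?thesis by (simp add: free_lift_def A_def)
  qed
  ultimately show ?thesis by (simp add: rmodule_hom_def)
qed

lemma free_lift_basis:
  assumes u: "u \<in> I \<rightarrow> carrier M" and i: "i \<in> I"
  shows "free_lift R M u (free_basis R i) = u i"
proof -
  have ui: "u i \<in> carrier M" using u i by auto
  have "free_lift R M u (free_basis R i) = finsum M (\<lambda>j. u j \<cdot>\<^bsub>M\<^esub> free_basis R i j) {i}"
    by (rule free_lift_superset[OF u R.free_basis_carrier[OF i]])
       (use i in \<open>auto simp: free_basis_def\<close>)
  also have "\<dots> = u i" using ui by (subst M.finsum_insert) (auto simp: free_basis_def)
  finally show ?thesis .
qed

end

lemma hom_free_lift:
  assumes "right_module R M" "right_module R N" "g \<in> rmodule_hom R M N"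
    "u \<in> I \<rightarrow> carrier M" "\<phi> \<in> carrier (free_module R I)"
  shows "g (free_lift R M u \<phi>) = free_lift R N (\<lambda>i. g (u i)) \<phi>"
proof -
  interpret M: right_module R M by fact
  interpret N: right_module R N by fact
  note g = rmodule_homD[OF assms(3)]
  let ?S = "{i. \<phi> i \<noteq> \<zero>\<^bsub>R\<^esub>}"
  have phi: "\<phi> i \<in> carrier R" "finite ?S" "?S \<subseteq> I" for i
    using assms(5) by (auto simp: free_module_def)
  have ui: "u i \<in> carrier M" if "i \<in> ?S" for i using that phi(3) assms(4) by blast
  have "g (free_lift R M u \<phi>) = finsum N (\<lambda>i. g (u i \<cdot>\<^bsub>M\<^esub> \<phi> i)) ?S"
    unfolding free_lift_def
    by (rule hom_finsum[OF M.M.abelian_group_axioms N.M.abelian_group_axioms])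
       (use phi ui g rmodule_hom_zero[OF assms(1-3)] in auto)
  also have "\<dots> = free_lift R N (\<lambda>i. g (u i)) \<phi>"
    unfolding free_lift_def by (rule N.M.finsum_cong') (use phi ui g in auto)
  finally show ?thesis .
qed

lemma rmodule_epi_hom: "f \<in> rmodule_epi R M N \<Longrightarrow> f \<in> rmodule_hom R M N"
  by (simp add: rmodule_epi_def)

lemma projective_lift:
  fixes R :: "('a, 'm) ring_scheme" and P :: "('a, 'p) rmodule"
    and M :: "('a, 'x) rmodule" and N :: "('a, 'y) rmodule"
  assumes "projective_module R P" "right_module R M" "right_module R N"
    "g \<in> rmodule_epi R M N" "f \<in> rmodule_hom R P N"
  shows "\<exists>h\<in>rmodule_hom R P M. \<forall>x\<in>carrier P. g (h x) = f x"
proof -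
  have P: "right_module R P" using assms(1) by (simp add: projective_module_def)
  interpret P: right_module R P by (rule P)
  interpret M: right_module R M by fact
  interpret N: right_module R N by fact
  let ?F = "free_module R (carrier P)"
  have F: "right_module R ?F" by (rule P.R.free_right_module)
  let ?e = "free_lift R P (\<lambda>x. x)"
  have ehom: "?e \<in> rmodule_hom R ?F P" by (rule P.free_lift_hom) simp
  have "x \<in> ?e ` carrier ?F" if "x \<in> carrier P" for x
    using P.free_lift_basis[of "\<lambda>x. x" "carrier P" x] P.R.free_basis_carrier[OF that] that
    by (metis Pi_I image_eqI)
  then have "?e \<in> rmodule_epi R ?F P"
    using ehom rmodule_homD(1)[OF ehom] by (auto simp: rmodule_epi_def)
  moreover have "(\<lambda>x. x) \<in> rmodule_hom R P P" by (simp add: rmodule_hom_def)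
  ultimately have "\<exists>s\<in>rmodule_hom R P ?F. \<forall>x\<in>carrier P. ?e (s x) = x"
    by (rule conjunct2[OF assms(1)[unfolded projective_module_def], rule_format, OF conjI[OF F P]])
  then obtain s where s: "s \<in> rmodule_hom R P ?F" "\<forall>x\<in>carrier P. ?e (s x) = x" by blast
  have g: "g \<in> rmodule_hom R M N" "g ` carrier M = carrier N"
    using assms(4) by (auto simp: rmodule_epi_def)
  have "\<exists>m\<in>carrier M. g m = f p" if "p \<in> carrier P" for p
    using g(2) rmodule_homD(1)[OF assms(5) that] by (metis imageE)
  then obtain u where u: "\<And>p. p \<in> carrier P \<Longrightarrow> u p \<in> carrier M"
    "\<And>p. p \<in> carrier P \<Longrightarrow> g (u p) = f p" by metis
  have uP: "u \<in> carrier P \<rightarrow> carrier M" using u(1) by blast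
  show ?thesis
  proof (intro bexI ballI)
    show "(\<lambda>x. free_lift R M u (s x)) \<in> rmodule_hom R P M"
      by (rule rmodule_hom_comp[OF s(1) M.free_lift_hom[OF uP]])
    fix x assume x: "x \<in> carrier P"
    have sx: "s x \<in> carrier ?F" using s(1) x by (rule rmodule_homD(1))
    have sx': "s x i \<in> carrier R" "s x i \<noteq> \<zero>\<^bsub>R\<^esub> \<Longrightarrow> i \<in> carrier P" for i
      using sx by (auto simp: free_module_def)
    have "g (free_lift R M u (s x)) = free_lift R N (\<lambda>p. g (u p)) (s x)"
      by (rule hom_free_lift[OF assms(2,3) g(1) uP sx])
    also have "\<dots> = free_lift R N f (s x)" unfolding free_lift_def
      by (rule N.M.finsum_cong') (use u(2) sx' rmodule_homD(1)[OF assms(5)] in auto)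
    also have "\<dots> = f (?e (s x))"
      by (rule hom_free_lift[OF P assms(3,5) _ sx, symmetric]) simp
    also have "\<dots> = f x" using s(2) x by simp
    finally show "g (free_lift R M u (s x)) = f x" .
  qed
qed


section \<open>Projective \<open>\<delta>\<close>-covers and modules of arbitrary types\<close>

text \<open>In \<open>has_projective_delta_coverI\<close> the cover \<open>P\<close> is replaced by the image \<open>X\<close> in \<open>P\<close> of the free
  module on \<open>L\<close>. Since the kernel is \<open>\<delta>\<close>-small, \<open>X\<close> is a direct summand of \<open>P\<close>, hence isomorphic to
  a submodule of that free module, and it still covers \<open>L\<close>.\<close>

context right_module
begin

lemma essential_residual:
  assumes E: "essential_submodule R M E" and x: "x \<in> carrier M"
  shows "essential_submodule R (regular_module R) {r \<in> carrier R. x \<cdot>\<^bsub>M\<^esub> r \<in> E}"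
proof -
  let ?I = "{r \<in> carrier R. x \<cdot>\<^bsub>M\<^esub> r \<in> E}"
  interpret Reg: right_module R "regular_module R" by (rule R.right_module_regular)
  have rs [simp]: "carrier (regular_module R) = carrier R" "\<zero>\<^bsub>regular_module R\<^esub> = \<zero>\<^bsub>R\<^esub>"
    "a \<oplus>\<^bsub>regular_module R\<^esub> b = a \<oplus>\<^bsub>R\<^esub> b" "a \<cdot>\<^bsub>regular_module R\<^esub> b = a \<otimes>\<^bsub>R\<^esub> b" for a b
    by (simp_all add: regular_module_def)
  have Es: "right_submodule R M E" using E by (simp add: essential_submodule_def)
  note E' = Es[unfolded right_submodule_iff]
  have I: "right_submodule R (regular_module R) ?I"
    unfolding Reg.right_submodule_iff using E' x by (auto simp: ract_r_distr ract_assoc)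
  moreover have "?I \<inter> J \<noteq> {\<zero>\<^bsub>R\<^esub>}"
    if J: "right_submodule R (regular_module R) J" "J \<noteq> {\<zero>\<^bsub>R\<^esub>}" for J
  proof -
    note J' = J(1)[unfolded Reg.right_submodule_iff, simplified]
    have JR: "J \<subseteq> carrier R" using J' by simp
    define X where "X = (\<lambda>r. x \<cdot>\<^bsub>M\<^esub> r) ` J"
    have "(\<lambda>r. x \<cdot>\<^bsub>M\<^esub> r) \<in> rmodule_hom R (regular_module R) M"
      using x by (auto simp: rmodule_hom_def ract_r_distr ract_assoc)
    from rmodule_hom_image[OF Reg.right_module_axioms right_module_axioms this J(1)]
    have X: "right_submodule R M X" by (simp add: X_def)
    show ?thesis
    proof (cases "X = {\<zero>\<^bsub>M\<^esub>}")
      case True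
      obtain r where r: "r \<in> J" "r \<noteq> \<zero>\<^bsub>R\<^esub>" using J(2) J' by blast
      then have "x \<cdot>\<^bsub>M\<^esub> r = \<zero>\<^bsub>M\<^esub>" using True by (auto simp: X_def)
      then have "r \<in> ?I \<inter> J" using r JR E' by auto
      then show ?thesis using r by blast
    next
      case False
      then have "E \<inter> X \<noteq> {\<zero>\<^bsub>M\<^esub>}" using E X by (simp add: essential_submodule_def)
      moreover have "\<zero>\<^bsub>M\<^esub> \<in> E \<inter> X" using E' X by (simp add: right_submodule_iff)
      ultimately obtain y where y: "y \<in> E" "y \<in> X" "y \<noteq> \<zero>\<^bsub>M\<^esub>" by blast
      then obtain r where r: "r \<in> J" "y = x \<cdot>\<^bsub>M\<^esub> r" by (auto simp: X_def)
      then have "r \<noteq> \<zero>\<^bsub>R\<^esub>" using y x by auto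
      moreover have "r \<in> ?I \<inter> J" using r y JR by auto
      ultimately show ?thesis by blast
    qed
  qed
  ultimately show ?thesis by (simp add: essential_submodule_def)
qed

lemma zero_submodule: "right_submodule R M {\<zero>\<^bsub>M\<^esub>}"
  by (simp add: right_submodule_iff)

lemma submodule_Union_chain:
  assumes "C \<noteq> {}" "\<And>Y. Y \<in> C \<Longrightarrow> right_submodule R M Y"
    "\<And>Y Z. Y \<in> C \<Longrightarrow> Z \<in> C \<Longrightarrow> Y \<subseteq> Z \<or> Z \<subseteq> Y"
  shows "right_submodule R M (\<Union>C)"
  unfolding right_submodule_iff
proof (intro conjI ballI)
  have s: "Y \<subseteq> carrier M" "\<zero>\<^bsub>M\<^esub> \<in> Y" "\<And>a b. a \<in> Y \<Longrightarrow> b \<in> Y \<Longrightarrow> a \<oplus>\<^bsub>M\<^esub> b \<in> Y"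
    "\<And>a r. a \<in> Y \<Longrightarrow> r \<in> carrier R \<Longrightarrow> a \<cdot>\<^bsub>M\<^esub> r \<in> Y" if "Y \<in> C" for Y
    using assms(2)[OF that] unfolding right_submodule_iff by blast+
  show "\<Union>C \<subseteq> carrier M" "\<zero>\<^bsub>M\<^esub> \<in> \<Union>C" using s assms(1) by blast+
  fix x assume "x \<in> \<Union>C"
  then obtain Y where Y: "Y \<in> C" "x \<in> Y" by blast
  { fix y assume "y \<in> \<Union>C"
    then obtain Z where Z: "Z \<in> C" "y \<in> Z" by blast
    from assms(3)[OF Y(1) Z(1)] show "x \<oplus>\<^bsub>M\<^esub> y \<in> \<Union>C"
      using s(3)[OF Y(1), of x y] s(3)[OF Z(1), of x y] Y Z by blast }
  fix r assume "r \<in> carrier R"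
  then show "x \<cdot>\<^bsub>M\<^esub> r \<in> \<Union>C" using s(4)[OF Y(1)] Y by blast
qed

lemma exists_essential_sum:
  assumes X: "right_submodule R M X"
  shows "\<exists>Y. right_submodule R M Y \<and> X \<inter> Y = {\<zero>\<^bsub>M\<^esub>} \<and> essential_submodule R M (X <+>\<^bsub>M\<^esub> Y)"
proof -
  define S where "S = {Y. right_submodule R M Y \<and> X \<inter> Y = {\<zero>\<^bsub>M\<^esub>}}"
  note X' = X[unfolded right_submodule_iff]
  have "{\<zero>\<^bsub>M\<^esub>} \<in> S" using X' zero_submodule by (auto simp: S_def)
  then have "S \<noteq> {}" by blast
  moreover have "\<Union>C \<in> S" if "C \<noteq> {}" "subset.chain S C" for C
  proof -
    have C: "C \<subseteq> S" "\<And>Y Z. Y \<in> C \<Longrightarrow> Z \<in> C \<Longrightarrow> Y \<subseteq> Z \<or> Z \<subseteq> Y"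
      using that(2) by (auto simp: subset_chain_def)
    then have "right_submodule R M (\<Union>C)"
      by (intro submodule_Union_chain that) (auto simp: S_def)
    moreover have "X \<inter> \<Union>C = {\<zero>\<^bsub>M\<^esub>}" using that(1) C(1) by (auto simp: S_def)
    ultimately show ?thesis by (simp add: S_def)
  qed
  ultimately obtain Y where Y: "Y \<in> S" "\<And>Z. Z \<in> S \<Longrightarrow> Y \<subseteq> Z \<Longrightarrow> Z = Y"
    using subset_Zorn_nonempty[of S] by blast
  have Ys: "right_submodule R M Y" "X \<inter> Y = {\<zero>\<^bsub>M\<^esub>}" using Y(1) by (auto simp: S_def)
  note Y' = Ys(1)[unfolded right_submodule_iff]
  have XY: "right_submodule R M (X <+>\<^bsub>M\<^esub> Y)" using X Ys(1) by (rule submodule_add)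
  have "W = {\<zero>\<^bsub>M\<^esub>}"
    if W: "right_submodule R M W" "(X <+>\<^bsub>M\<^esub> Y) \<inter> W = {\<zero>\<^bsub>M\<^esub>}" for W
  proof -
    note W' = W(1)[unfolded right_submodule_iff]
    have YW: "right_submodule R M (Y <+>\<^bsub>M\<^esub> W)" using Ys(1) W(1) by (rule submodule_add)
    have "x = \<zero>\<^bsub>M\<^esub>" if x: "x \<in> X" "x \<in> Y <+>\<^bsub>M\<^esub> W" for x
    proof -
      obtain y w where yw: "y \<in> Y" "w \<in> W" "x = y \<oplus>\<^bsub>M\<^esub> w" using x(2) unfolding mem_set_add by blast
      have c: "x \<in> carrier M" "y \<in> carrier M" "w \<in> carrier M" using x yw X' Y' W' by auto
      have my: "\<ominus>\<^bsub>M\<^esub> y \<in> Y"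
        using submodule_minus[OF Ys(1), of "\<zero>\<^bsub>M\<^esub>" y] Y' yw c by (simp add: a_minus_def)
      have "w = x \<oplus>\<^bsub>M\<^esub> (\<ominus>\<^bsub>M\<^esub> y)" using c yw(3) by (simp add: M.a_ac M.r_neg M.r_neg1 M.r_neg2)
      then have "w \<in> X <+>\<^bsub>M\<^esub> Y" unfolding mem_set_add using x my by blast
      then have "w = \<zero>\<^bsub>M\<^esub>" using W(2) yw(2) by blast
      then have "x = y" using yw c by simp
      then show ?thesis using Ys(2) x yw by blast
    qed
    moreover have "\<zero>\<^bsub>M\<^esub> \<in> X \<inter> (Y <+>\<^bsub>M\<^esub> W)" using YW X' by (simp add: right_submodule_iff)
    ultimately have "Y <+>\<^bsub>M\<^esub> W \<in> S" using YW by (auto simp: S_def)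
    moreover have "Y \<subseteq> Y <+>\<^bsub>M\<^esub> W"
    proof
      fix y assume "y \<in> Y"
      then show "y \<in> Y <+>\<^bsub>M\<^esub> W" unfolding mem_set_add using W' Y'
        by (intro bexI[of _ y] bexI[of _ "\<zero>\<^bsub>M\<^esub>"]) auto
    qed
    ultimately have eq: "Y <+>\<^bsub>M\<^esub> W = Y" by (rule Y(2))
    have "w = \<zero>\<^bsub>M\<^esub>" if w: "w \<in> W" for w
    proof -
      have wc: "w \<in> carrier M" using w W' by blast
      have "w \<in> Y <+>\<^bsub>M\<^esub> W" unfolding mem_set_add using w wc Y'
        by (intro bexI[of _ "\<zero>\<^bsub>M\<^esub>"] bexI[of _ w]) auto
      then have "w \<in> Y" using eq by simp
      then have "w \<in> X <+>\<^bsub>M\<^esub> Y" unfolding mem_set_add using wc X'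
        by (intro bexI[of _ "\<zero>\<^bsub>M\<^esub>"] bexI[of _ w]) auto
      then show ?thesis using W(2) w by blast
    qed
    then show ?thesis using W' by blast
  qed
  then have "essential_submodule R M (X <+>\<^bsub>M\<^esub> Y)"
    using XY by (auto simp: essential_submodule_def)
  then show ?thesis using Ys by blast
qed

lemma delta_small_complement:
  assumes X: "right_submodule R M X" and K: "delta_small R M K"
    and sum: "carrier M = X <+>\<^bsub>M\<^esub> K"
  shows "\<exists>Y. direct_decomposition R M X Y"
proof -
  obtain Y where Y: "right_submodule R M Y" "X \<inter> Y = {\<zero>\<^bsub>M\<^esub>}"
    "essential_submodule R M (X <+>\<^bsub>M\<^esub> Y)"
    using exists_essential_sum[OF X] by blast
  let ?E = "X <+>\<^bsub>M\<^esub> Y"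
  have E: "right_submodule R M ?E" using X Y(1) by (rule submodule_add)
  have "right_submodule R M K" using K by (simp add: delta_small_def)
  note X' = X[unfolded right_submodule_iff] and Y' = Y(1)[unfolded right_submodule_iff]
    and K' = this[unfolded right_submodule_iff]
  have "singular_module R (quot_module M ?E)"
    unfolding singular_quot_iff[OF E] using essential_residual[OF Y(3)] by blast
  moreover have "carrier M = K <+>\<^bsub>M\<^esub> ?E"
  proof
    show "K <+>\<^bsub>M\<^esub> ?E \<subseteq> carrier M"
      by (rule M.setadd_subset_G) (use K' E[unfolded right_submodule_iff] in blast)+
    show "carrier M \<subseteq> K <+>\<^bsub>M\<^esub> ?E"
    proof
      fix z assume "z \<in> carrier M"
      then obtain x k where z: "x \<in> X" "k \<in> K" "z = x \<oplus>\<^bsub>M\<^esub> k"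
        unfolding sum mem_set_add by blast
      have c: "x \<in> carrier M" "k \<in> carrier M" using z X' K' by auto
      have "x \<in> ?E" unfolding mem_set_add using z c Y' by (intro bexI[of _ x] bexI[of _ "\<zero>\<^bsub>M\<^esub>"]) auto
      moreover have "z = k \<oplus>\<^bsub>M\<^esub> x" using z c by (simp add: M.a_comm)
      ultimately show "z \<in> K <+>\<^bsub>M\<^esub> ?E" unfolding mem_set_add[of z] using z(2) by blast
    qed
  qed
  ultimately have "carrier M = ?E" using K E unfolding delta_small_def by blast
  then show ?thesis using X Y by (auto simp: direct_decomposition_def)
qed

lemma decomposition_projection:
  assumes "direct_decomposition R M A B"
  shows "\<exists>\<pi>\<in>rmodule_hom R M (M\<lparr>carrier := A\<rparr>).
    (\<forall>a\<in>A. \<pi> a = a) \<and> (\<forall>x\<in>carrier M. \<exists>b\<in>B. x = \<pi> x \<oplus>\<^bsub>M\<^esub> b)"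
proof -
  have A: "right_submodule R M A" and B: "right_submodule R M B"
    and sum: "carrier M = A <+>\<^bsub>M\<^esub> B" and int: "A \<inter> B = {\<zero>\<^bsub>M\<^esub>}"
    using assms by (auto simp: direct_decomposition_def)
  note A' = A[unfolded right_submodule_iff] and B' = B[unfolded right_submodule_iff]
  have Ac: "a \<in> carrier M" if "a \<in> A" for a using that A' by blast
  have Bc: "a \<in> carrier M" if "a \<in> B" for a using that B' by blast
  have uniq: "a = a'" if h: "a \<in> A" "a' \<in> A" "b \<in> B" "b' \<in> B" "a \<oplus>\<^bsub>M\<^esub> b = a' \<oplus>\<^bsub>M\<^esub> b'" for a a' b b'
  proof -
    note c = Ac[OF h(1)] Ac[OF h(2)] Bc[OF h(3)] Bc[OF h(4)]
    have "a \<ominus>\<^bsub>M\<^esub> a' = (a \<oplus>\<^bsub>M\<^esub> b) \<ominus>\<^bsub>M\<^esub> (a' \<oplus>\<^bsub>M\<^esub> b)"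
      using c by (simp add: a_minus_def M.minus_add M.a_ac M.r_neg M.r_neg1 M.r_neg2)
    also have "\<dots> = (a' \<oplus>\<^bsub>M\<^esub> b') \<ominus>\<^bsub>M\<^esub> (a' \<oplus>\<^bsub>M\<^esub> b)" using h(5) by simp
    also have "\<dots> = a' \<oplus>\<^bsub>M\<^esub> (b' \<oplus>\<^bsub>M\<^esub> (\<ominus>\<^bsub>M\<^esub> a' \<oplus>\<^bsub>M\<^esub> \<ominus>\<^bsub>M\<^esub> b))"
      using c by (simp add: a_minus_def M.minus_add M.a_assoc)
    also have "b' \<oplus>\<^bsub>M\<^esub> (\<ominus>\<^bsub>M\<^esub> a' \<oplus>\<^bsub>M\<^esub> \<ominus>\<^bsub>M\<^esub> b) = \<ominus>\<^bsub>M\<^esub> a' \<oplus>\<^bsub>M\<^esub> (b' \<oplus>\<^bsub>M\<^esub> \<ominus>\<^bsub>M\<^esub> b)"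
      using c by (intro M.add.m_lcomm) auto
    also have "a' \<oplus>\<^bsub>M\<^esub> (\<ominus>\<^bsub>M\<^esub> a' \<oplus>\<^bsub>M\<^esub> (b' \<oplus>\<^bsub>M\<^esub> \<ominus>\<^bsub>M\<^esub> b)) = b' \<ominus>\<^bsub>M\<^esub> b"
      using c by (simp add: a_minus_def M.r_neg2)
    finally have "a \<ominus>\<^bsub>M\<^esub> a' \<in> A \<inter> B"
      using submodule_minus[OF A h(1,2)] submodule_minus[OF B h(4,3)] by simp
    then have "a \<ominus>\<^bsub>M\<^esub> a' = \<zero>\<^bsub>M\<^esub>" using int by blast
    moreover have "a = (a \<ominus>\<^bsub>M\<^esub> a') \<oplus>\<^bsub>M\<^esub> a'" using c by (simp add: a_minus_def M.a_assoc M.l_neg)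
    ultimately show ?thesis using c by simp
  qed
  have "\<exists>a b. a \<in> A \<and> b \<in> B \<and> x = a \<oplus>\<^bsub>M\<^esub> b" if "x \<in> carrier M" for x
    using that unfolding sum mem_set_add by blast
  then obtain \<pi> \<rho> where pr: "\<And>x. x \<in> carrier M \<Longrightarrow> \<pi> x \<in> A \<and> \<rho> x \<in> B \<and> x = \<pi> x \<oplus>\<^bsub>M\<^esub> \<rho> x"
    by metis
  have eqI: "\<pi> x = a" if "x \<in> carrier M" "a \<in> A" "b \<in> B" "x = a \<oplus>\<^bsub>M\<^esub> b" for x a b
    using uniq[of "\<pi> x" a "\<rho> x" b] pr[OF that(1)] that by simp
  have "\<pi> (x \<oplus>\<^bsub>M\<^esub> y) = \<pi> x \<oplus>\<^bsub>M\<^esub> \<pi> y" if xy: "x \<in> carrier M" "y \<in> carrier M" for x y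
  proof (rule eqI)
    show "\<pi> x \<oplus>\<^bsub>M\<^esub> \<pi> y \<in> A" "\<rho> x \<oplus>\<^bsub>M\<^esub> \<rho> y \<in> B" using pr xy A' B' by auto
    have c: "\<pi> x \<in> carrier M" "\<pi> y \<in> carrier M" "\<rho> x \<in> carrier M" "\<rho> y \<in> carrier M"
      using pr xy Ac Bc by auto
    have "x \<oplus>\<^bsub>M\<^esub> y = (\<pi> x \<oplus>\<^bsub>M\<^esub> \<rho> x) \<oplus>\<^bsub>M\<^esub> (\<pi> y \<oplus>\<^bsub>M\<^esub> \<rho> y)" using pr xy by metis
    then show "x \<oplus>\<^bsub>M\<^esub> y = \<pi> x \<oplus>\<^bsub>M\<^esub> \<pi> y \<oplus>\<^bsub>M\<^esub> (\<rho> x \<oplus>\<^bsub>M\<^esub> \<rho> y)" using c by (simp add: M.a_ac)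
  qed (use xy in simp)
  moreover have "\<pi> (x \<cdot>\<^bsub>M\<^esub> r) = \<pi> x \<cdot>\<^bsub>M\<^esub> r" if xr: "x \<in> carrier M" "r \<in> carrier R" for x r
  proof (rule eqI)
    show "\<pi> x \<cdot>\<^bsub>M\<^esub> r \<in> A" "\<rho> x \<cdot>\<^bsub>M\<^esub> r \<in> B" using pr xr A' B' by auto
    have "x \<cdot>\<^bsub>M\<^esub> r = (\<pi> x \<oplus>\<^bsub>M\<^esub> \<rho> x) \<cdot>\<^bsub>M\<^esub> r" using pr xr by metis
    then show "x \<cdot>\<^bsub>M\<^esub> r = \<pi> x \<cdot>\<^bsub>M\<^esub> r \<oplus>\<^bsub>M\<^esub> \<rho> x \<cdot>\<^bsub>M\<^esub> r"
      using pr[OF xr(1)] Ac Bc xr ract_l_distr[of "\<pi> x" "\<rho> x" r] by simp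
  qed (use xr in simp)
  ultimately have "\<pi> \<in> rmodule_hom R M (M\<lparr>carrier := A\<rparr>)"
    using pr by (auto simp: rmodule_hom_def)
  moreover have "\<pi> a = a" if "a \<in> A" for a
    by (rule eqI[of _ _ "\<zero>\<^bsub>M\<^esub>"]) (use that Ac B' in auto)
  moreover have "\<exists>b\<in>B. x = \<pi> x \<oplus>\<^bsub>M\<^esub> b" if "x \<in> carrier M" for x using pr[OF that] by blast
  ultimately show ?thesis by blast
qed

end

lemma has_projective_delta_coverI:
  fixes R :: "('a, 'm) ring_scheme" and P :: "('a, 'p) rmodule" and L :: "('a, 'l) rmodule"
  assumes L: "right_module R L" and cover: "projective_delta_cover R P q L"
  shows "has_projective_delta_cover R L"
proof -
  have proj: "projective_module R P" and q: "q \<in> rmodule_hom R P L" "q ` carrier P = carrier L"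
    and K: "delta_small R P (a_kernel P L q)"
    using cover by (auto simp: projective_delta_cover_def rmodule_epi_def)
  have P: "right_module R P" using proj by (simp add: projective_module_def)
  interpret P: right_module R P by (rule P)
  interpret L: right_module R L by (rule L)
  let ?K = "a_kernel P L q"
  let ?F = "free_module R (carrier L)"
  have F: "right_module R ?F" by (rule P.R.free_right_module)
  interpret F: right_module R ?F by (rule F)
  note q' = rmodule_homD[OF q(1)]
  have "\<exists>p\<in>carrier P. q p = l" if "l \<in> carrier L" for l using that q(2) by (metis imageE)
  then obtain u where u: "\<And>l. l \<in> carrier L \<Longrightarrow> u l \<in> carrier P"
    "\<And>l. l \<in> carrier L \<Longrightarrow> q (u l) = l" by metis
  define e where "e = free_lift R P u"
  have uL: "u \<in> carrier L \<rightarrow> carrier P" using u(1) by blast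
  have e: "e \<in> rmodule_hom R ?F P" unfolding e_def by (rule P.free_lift_hom[OF uL])
  note e' = rmodule_homD[OF e]
  define X where "X = e ` carrier ?F"
  have X: "right_submodule R P X"
    unfolding X_def by (rule rmodule_hom_image[OF F P e right_submodule_carrier[OF F]])
  note X' = X[unfolded P.right_submodule_iff]
  have uX: "u l \<in> X" if "l \<in> carrier L" for l
    using P.free_lift_basis[OF uL that] P.R.free_basis_carrier[OF that]
    unfolding X_def e_def by (metis image_eqI)
  have Kc: "k \<in> carrier P" "q k = \<zero>\<^bsub>L\<^esub>" if "k \<in> ?K" for k using that by (auto simp: a_kernel_def')
  have "carrier P = X <+>\<^bsub>P\<^esub> ?K"
  proof
    show "X <+>\<^bsub>P\<^esub> ?K \<subseteq> carrier P" using X' Kc by (intro P.M.setadd_subset_G) auto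
    show "carrier P \<subseteq> X <+>\<^bsub>P\<^esub> ?K"
    proof
      fix p assume p: "p \<in> carrier P"
      let ?x = "u (q p)"
      have x: "?x \<in> X" "?x \<in> carrier P" "q ?x = q p" using p q' uX u by auto
      let ?k = "?x \<cdot>\<^bsub>P\<^esub> (\<ominus>\<^bsub>R\<^esub> \<one>\<^bsub>R\<^esub>) \<oplus>\<^bsub>P\<^esub> p"
      have "q ?k = q p \<cdot>\<^bsub>L\<^esub> (\<ominus>\<^bsub>R\<^esub> \<one>\<^bsub>R\<^esub>) \<oplus>\<^bsub>L\<^esub> q p" using x p q' by simp
      also have "\<dots> = \<zero>\<^bsub>L\<^esub>" using q' p by (simp add: L.ract_minus_one L.M.l_neg)
      finally have "?k \<in> ?K" using x p by (simp add: a_kernel_def')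
      moreover have "p = ?x \<oplus>\<^bsub>P\<^esub> ?k" using x p by (simp add: P.ract_minus_one P.M.r_neg2)
      ultimately show "p \<in> X <+>\<^bsub>P\<^esub> ?K" unfolding P.mem_set_add using x(1) by blast
    qed
  qed
  from P.delta_small_complement[OF X K this] obtain Y where XY: "direct_decomposition R P X Y"
    by blast
  then have Y: "right_submodule R P Y" and sum: "carrier P = X <+>\<^bsub>P\<^esub> Y"
    and int: "X \<inter> Y = {\<zero>\<^bsub>P\<^esub>}" by (auto simp: direct_decomposition_def)
  note Y' = Y[unfolded P.right_submodule_iff]
  let ?X = "P\<lparr>carrier := X\<rparr>"
  have Xm: "right_module R ?X" using X by (rule P.submodule_right_module)
  obtain \<pi> where pi: "\<pi> \<in> rmodule_hom R P ?X" "\<And>x. x \<in> X \<Longrightarrow> \<pi> x = x"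
    "\<And>p. p \<in> carrier P \<Longrightarrow> \<exists>y\<in>Y. p = \<pi> p \<oplus>\<^bsub>P\<^esub> y"
    using P.decomposition_projection[OF XY] by blast
  have piX: "\<pi> p \<in> X" if "p \<in> carrier P" for p using rmodule_homD(1)[OF pi(1) that] by simp
  have "e \<in> rmodule_epi R ?F ?X"
    using e by (auto simp: rmodule_epi_def rmodule_hom_def X_def)
  from projective_lift[OF proj F Xm this pi(1)]
  obtain h where h: "h \<in> rmodule_hom R P ?F" "\<And>p. p \<in> carrier P \<Longrightarrow> e (h p) = \<pi> p" by blast
  note h' = rmodule_homD[OF h(1)]
  define Q where "Q = h ` X"
  have Q: "right_submodule R ?F Q" unfolding Q_def by (rule rmodule_hom_image[OF P F h(1) X])
  note Q'' = Q[unfolded F.right_submodule_iff]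
  let ?Q = "?F\<lparr>carrier := Q\<rparr>"
  have Qm: "right_module R ?Q" using Q by (rule F.submodule_right_module)
  interpret Q: right_module R ?Q by (rule Qm)
  have Xc: "x \<in> carrier P" if "x \<in> X" for x using that X' by blast
  have Qc: "y \<in> carrier ?F" if "y \<in> Q" for y using that Q'' by blast
  have eh: "e (h x) = x" if "x \<in> X" for x using h(2) pi(2) Xc that by simp
  have eQ: "e y \<in> X" "h (e y) = y" if "y \<in> Q" for y using that eh by (auto simp: Q_def)
  have eQhom: "e \<in> rmodule_hom R ?Q P" using e Qc by (auto simp: rmodule_hom_def)
  have hpihom: "(\<lambda>p. h (\<pi> p)) \<in> rmodule_hom R P ?Q"
  proof -
    have "\<pi> \<in> rmodule_hom R P P" using pi(1) Xc by (auto simp: rmodule_hom_def)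
    from rmodule_hom_comp[OF this h(1)] show ?thesis
      using piX by (auto simp: rmodule_hom_def Q_def)
  qed
  have "projective_module R ?Q"
    unfolding projective_module_def
  proof (intro conjI allI impI ballI Qm)
    fix M :: "('a, ('l \<Rightarrow> 'a) \<Rightarrow> 'a) rmodule" and N :: "('a, 'l \<Rightarrow> 'a) rmodule" and g f
    assume MN: "right_module R M \<and> right_module R N" and g: "g \<in> rmodule_epi R M N"
      and f: "f \<in> rmodule_hom R ?Q N"
    have "(\<lambda>p. f (h (\<pi> p))) \<in> rmodule_hom R P N" by (rule rmodule_hom_comp[OF hpihom f])
    from projective_lift[OF proj conjunct1[OF MN] conjunct2[OF MN] g this]
    obtain k where k: "k \<in> rmodule_hom R P M" "\<And>p. p \<in> carrier P \<Longrightarrow> g (k p) = f (h (\<pi> p))"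
      by blast
    show "\<exists>k\<in>rmodule_hom R ?Q M. \<forall>x\<in>carrier ?Q. g (k x) = f x"
    proof (intro bexI ballI)
      show "(\<lambda>y. k (e y)) \<in> rmodule_hom R ?Q M" by (rule rmodule_hom_comp[OF eQhom k(1)])
      fix y assume "y \<in> carrier ?Q"
      then have y: "y \<in> Q" by simp
      then show "g (k (e y)) = f y" using k(2)[of "e y"] eQ[OF y] Xc pi(2) by simp
    qed
  qed
  moreover define c where "c = (\<lambda>y. q (e y))"
  have chom: "c \<in> rmodule_hom R ?Q L" unfolding c_def by (rule rmodule_hom_comp[OF eQhom q(1)])
  have "l \<in> c ` Q" if "l \<in> carrier L" for l
  proof
    show "h (u l) \<in> Q" using uX[OF that] by (simp add: Q_def)
    show "l = c (h (u l))" using uX[OF that] u that by (simp add: c_def eh)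
  qed
  then have "c \<in> rmodule_epi R ?Q L"
    using chom rmodule_homD(1)[OF chom] by (auto simp: rmodule_epi_def)
  moreover have "delta_small R ?Q (a_kernel ?Q L c)"
    unfolding delta_small_def
  proof (intro conjI allI impI)
    show "right_submodule R ?Q (a_kernel ?Q L c)" by (rule rmodule_hom_kernel[OF Qm L chom])
    fix Z
    assume "right_submodule R ?Q Z \<and> carrier ?Q = a_kernel ?Q L c <+>\<^bsub>?Q\<^esub> Z \<and>
      singular_module R (quot_module ?Q Z)"
    then have Z: "right_submodule R ?Q Z" and sumZ: "Q = a_kernel ?Q L c <+>\<^bsub>?Q\<^esub> Z"
      and sing: "\<forall>y\<in>Q. essential_submodule R (regular_module R) {r \<in> carrier R. y \<cdot>\<^bsub>?F\<^esub> r \<in> Z}"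
      using Q.singular_quot_iff[of Z] by auto
    have ZQ: "Z \<subseteq> Q" using Z F.submodule_submodule[OF Q] by blast
    define eZ where "eZ = e ` Z"
    have eZ: "right_submodule R P eZ"
      unfolding eZ_def by (rule rmodule_hom_image[OF Qm P eQhom Z])
    have eZX: "eZ \<subseteq> X" using ZQ eQ by (auto simp: eZ_def)
    define W where "W = eZ <+>\<^bsub>P\<^esub> Y"
    have W: "right_submodule R P W" unfolding W_def using eZ Y by (rule P.submodule_add)
    note W' = W[unfolded P.right_submodule_iff]
    have "singular_module R (quot_module P W)"
      unfolding P.singular_quot_iff[OF W]
    proof
      fix p assume p: "p \<in> carrier P"
      obtain y where y: "y \<in> Y" "p = \<pi> p \<oplus>\<^bsub>P\<^esub> y" using pi(3)[OF p] by blast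
      let ?y = "h (\<pi> p)"
      have yQ: "?y \<in> Q" using piX[OF p] by (simp add: Q_def)
      have ey: "e ?y = \<pi> p" using piX[OF p] by (rule eh)
      let ?I = "{r \<in> carrier R. ?y \<cdot>\<^bsub>?F\<^esub> r \<in> Z}" and ?J = "{r \<in> carrier R. p \<cdot>\<^bsub>P\<^esub> r \<in> W}"
      have I: "essential_submodule R (regular_module R) ?I" using sing yQ by blast
      have IJ: "?I \<subseteq> ?J"
      proof safe
        fix r assume r: "r \<in> carrier R" "?y \<cdot>\<^bsub>?F\<^esub> r \<in> Z"
        have "p \<cdot>\<^bsub>P\<^esub> r = \<pi> p \<cdot>\<^bsub>P\<^esub> r \<oplus>\<^bsub>P\<^esub> y \<cdot>\<^bsub>P\<^esub> r"
          using P.ract_l_distr[of "\<pi> p" y r] piX[OF p] Xc y Y' r by auto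
        moreover have "\<pi> p \<cdot>\<^bsub>P\<^esub> r = e (?y \<cdot>\<^bsub>?F\<^esub> r)" using e'(3)[OF Qc[OF yQ] r(1)] ey by simp
        then have "\<pi> p \<cdot>\<^bsub>P\<^esub> r \<in> eZ" using r by (auto simp: eZ_def)
        moreover have "y \<cdot>\<^bsub>P\<^esub> r \<in> Y" using y Y' r by blast
        ultimately show "p \<cdot>\<^bsub>P\<^esub> r \<in> W" unfolding W_def P.mem_set_add by blast
      qed
      interpret Reg: right_module R "regular_module R" by (rule P.R.right_module_regular)
      have J: "right_submodule R (regular_module R) ?J"
        unfolding Reg.right_submodule_iff using W' p
        by (auto simp: regular_module_def P.ract_r_distr P.ract_assoc)
      show "essential_submodule R (regular_module R) ?J"
        unfolding essential_submodule_def
      proof (intro conjI allI impI J)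
        fix V assume V: "right_submodule R (regular_module R) V \<and> V \<noteq> {\<zero>\<^bsub>regular_module R\<^esub>}"
        then have "?I \<inter> V \<noteq> {\<zero>\<^bsub>regular_module R\<^esub>}" using I unfolding essential_submodule_def by blast
        moreover have "\<zero>\<^bsub>regular_module R\<^esub> \<in> ?I \<inter> V"
          using V I unfolding essential_submodule_def Reg.right_submodule_iff by blast
        ultimately show "?J \<inter> V \<noteq> {\<zero>\<^bsub>regular_module R\<^esub>}" using IJ by blast
      qed
    qed
    moreover have "carrier P = ?K <+>\<^bsub>P\<^esub> W"
    proof
      show "?K <+>\<^bsub>P\<^esub> W \<subseteq> carrier P" using W' Kc by (intro P.M.setadd_subset_G) auto
      show "carrier P \<subseteq> ?K <+>\<^bsub>P\<^esub> W"
      proof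
        fix p assume p: "p \<in> carrier P"
        obtain y where y: "y \<in> Y" "p = \<pi> p \<oplus>\<^bsub>P\<^esub> y" using pi(3)[OF p] by blast
        have "h (\<pi> p) \<in> Q" using piX[OF p] by (simp add: Q_def)
        then obtain k z where kz: "k \<in> a_kernel ?Q L c" "z \<in> Z" "h (\<pi> p) = k \<oplus>\<^bsub>?F\<^esub> z"
          using sumZ Q.mem_set_add[of "h (\<pi> p)" "a_kernel ?Q L c" Z] by auto
        have k: "k \<in> Q" "q (e k) = \<zero>\<^bsub>L\<^esub>" using kz(1) by (auto simp: a_kernel_def' c_def)
        have c: "k \<in> carrier ?F" "z \<in> carrier ?F" using k kz ZQ Qc by auto
        have ek: "e k \<in> ?K" using k e' c by (simp add: a_kernel_def')
        have "\<pi> p = e (k \<oplus>\<^bsub>?F\<^esub> z)" using eh[OF piX[OF p]] kz(3) by simp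
        then have "\<pi> p = e k \<oplus>\<^bsub>P\<^esub> e z" using e'(2)[OF c] by simp
        then have "p = (e k \<oplus>\<^bsub>P\<^esub> e z) \<oplus>\<^bsub>P\<^esub> y" using y(2) by simp
        then have "p = e k \<oplus>\<^bsub>P\<^esub> (e z \<oplus>\<^bsub>P\<^esub> y)" using e'(1) c y Y' by (simp add: P.M.a_assoc subset_iff)
        moreover have "e z \<oplus>\<^bsub>P\<^esub> y \<in> W" unfolding W_def P.mem_set_add eZ_def using kz(2) y by blast
        ultimately show "p \<in> ?K <+>\<^bsub>P\<^esub> W" unfolding P.mem_set_add using ek by blast
      qed
    qed
    ultimately have PW: "carrier P = W" using K W unfolding delta_small_def by blast
    have "x \<in> eZ" if x: "x \<in> X" for x
    proof -
      have "x \<in> W" using Xc[OF x] PW by simp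
      then obtain a y where a: "a \<in> eZ" "y \<in> Y" "x = a \<oplus>\<^bsub>P\<^esub> y"
        unfolding W_def P.mem_set_add by blast
      have ac: "a \<in> X" "a \<in> carrier P" "y \<in> carrier P" "x \<in> carrier P" using a eZX Xc Y' x by auto
      have "x = y \<oplus>\<^bsub>P\<^esub> a" using ac a(3) by (simp add: P.M.a_comm)
      then have "x \<ominus>\<^bsub>P\<^esub> a = y" using ac by (simp add: a_minus_def P.M.a_assoc P.M.r_neg)
      then have "y \<in> X" using P.submodule_minus[OF X x ac(1)] by simp
      then have "y = \<zero>\<^bsub>P\<^esub>" using int a(2) by blast
      then show ?thesis using a ac by simp
    qed
    then have "Q \<subseteq> Z" using eQ ZQ by (auto simp: eZ_def) (metis imageE subsetD)
    then show "carrier ?Q = Z" using ZQ by simp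
  qed
  ultimately have "projective_delta_cover R ?Q c L"
    by (simp add: projective_delta_cover_def)
  then show ?thesis unfolding has_projective_delta_cover_def by blast
qed

lemma projective_delta_cover_isomorphic:
  assumes N: "right_module R N" and L: "right_module R L"
    and iso: "rmodule_isomorphic R L N" and cover: "projective_delta_cover R P q N"
  shows "\<exists>f. projective_delta_cover R P f L"
proof -
  obtain j where j: "j \<in> rmodule_hom R L N" "bij_betw j (carrier L) (carrier N)"
    using iso by (auto simp: rmodule_isomorphic_def)
  interpret N: right_module R N by (rule N)
  interpret L: right_module R L by (rule L)
  note j' = rmodule_homD[OF j(1)]
  define i where "i = inv_into (carrier L) j"
  have ij: "i x \<in> carrier L" "j (i x) = x" if "x \<in> carrier N" for x
    using that j(2) unfolding i_def bij_betw_def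
    by (auto intro: inv_into_into f_inv_into_f)
  have ji: "i (j x) = x" if "x \<in> carrier L" for x
    using that j(2) unfolding i_def bij_betw_def by simp
  have i: "i \<in> rmodule_hom R N L"
    unfolding rmodule_hom_def
  proof (intro CollectI conjI ballI)
    show "i \<in> carrier N \<rightarrow> carrier L" using ij by blast
    fix x assume x: "x \<in> carrier N"
    { fix y assume y: "y \<in> carrier N"
      have "i (x \<oplus>\<^bsub>N\<^esub> y) = i (j (i x \<oplus>\<^bsub>L\<^esub> i y))" using x y ij j' by simp
      then show "i (x \<oplus>\<^bsub>N\<^esub> y) = i x \<oplus>\<^bsub>L\<^esub> i y" using x y ij ji by simp }
    fix r assume r: "r \<in> carrier R"
    have "i (x \<cdot>\<^bsub>N\<^esub> r) = i (j (i x \<cdot>\<^bsub>L\<^esub> r))" using x r ij j' by simp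
    then show "i (x \<cdot>\<^bsub>N\<^esub> r) = i x \<cdot>\<^bsub>L\<^esub> r" using x r ij ji by simp
  qed
  have q: "q \<in> rmodule_hom R P N" "q ` carrier P = carrier N"
    using cover by (auto simp: projective_delta_cover_def rmodule_epi_def)
  have "i ` carrier N = carrier L"
  proof
    show "i ` carrier N \<subseteq> carrier L" using ij by blast
    show "carrier L \<subseteq> i ` carrier N" using ji j'(1) by (metis image_eqI subsetI)
  qed
  then have "(\<lambda>x. i (q x)) ` carrier P = carrier L" using q(2) by (metis image_image)
  then have epi: "(\<lambda>x. i (q x)) \<in> rmodule_epi R P L"
    using rmodule_hom_comp[OF q(1) i] by (simp add: rmodule_epi_def)
  have "i y = \<zero>\<^bsub>L\<^esub> \<longleftrightarrow> y = \<zero>\<^bsub>N\<^esub>" if "y \<in> carrier N" for y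
    using ij(2)[OF that] rmodule_hom_zero[OF L N j(1)] rmodule_hom_zero[OF N L i] by auto
  then have "a_kernel P L (\<lambda>x. i (q x)) = a_kernel P N q"
    using rmodule_homD(1)[OF q(1)] by (auto simp: a_kernel_def')
  then have "projective_delta_cover R P (\<lambda>x. i (q x)) L"
    using cover epi by (simp add: projective_delta_cover_def)
  then show ?thesis by blast
qed

lemma delta_semiregular_cover:
  fixes R :: "('a, 'm) ring_scheme" and L :: "('a, 'l) rmodule"
  assumes R: "delta_semiregular_ring R" and L: "cyclically_presented R L"
  shows "has_projective_delta_cover R L"
proof -
  have Lm: "right_module R L" using L by (simp add: cyclically_presented_def)
  interpret L: right_module R L by (rule Lm)
  let ?N = "\<lambda>a. quot_module (regular_module R) (principal_submodule R (regular_module R) a)"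
  obtain a where a: "a \<in> carrier R" "rmodule_isomorphic R L (?N a)"
    using L by (auto simp: cyclically_presented_def)
  interpret Reg: right_module R "regular_module R" by (rule L.R.right_module_regular)
  have "a \<in> carrier (regular_module R)" using a by (simp add: regular_module_def)
  then have N: "right_module R (?N a)"
    by (intro Reg.quot_right_module Reg.principal_right_submodule)
  have "rmodule_isomorphic R (?N a) (?N a)"
    unfolding rmodule_isomorphic_def
    by (intro bexI[of _ "\<lambda>x. x"]) (auto simp: rmodule_hom_def bij_betw_def)
  then have "cyclically_presented R (?N a)"
    using N a(1) by (auto simp: cyclically_presented_def)
  then obtain P :: "('a, 'a set \<Rightarrow> 'a) rmodule" and q where "projective_delta_cover R P q (?N a)"
    using R unfolding delta_semiregular_ring_def has_projective_delta_cover_def by blast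
  from projective_delta_cover_isomorphic[OF N Lm a(2) this] show ?thesis
    using has_projective_delta_coverI[OF Lm] by blast
qed

end

(* If P is a projective delta-cover of M/N with M projective, the projection M -> M/N lifts to
   h : M -> P. Since the kernel of the cover is delta-small, h(M) is a direct summand of P, so h
   splits off its kernel, M = Ker h + B. Here Ker h lies in N, and N \<inter> B lies in the image of the
   delta-small kernel of the cover under the splitting P -> B. Conversely, if M = A + B with A in N,
   then B -> M/N is onto with kernel N \<inter> B. Both directions hold for every projective module M; the
   theorem is the case M = R, N = aR. *)

theory Submission
  imports Defs
begin

section \<open>Quotients, direct decompositions and \<delta>-small submodules\<close>

context right_module
begin

lemma coset_epi:
  assumes X: "right_submodule R M X"
  shows "(\<lambda>x. X +>\<^bsub>M\<^esub> x) \<in> rmodule_epi R M (quot_module M X)"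
proof -
  interpret X: abelian_subgroup X M using X by (rule abelian_subgroup_submodule)
  have "(X +>\<^bsub>M\<^esub> x) \<oplus>\<^bsub>quot_module M X\<^esub> (X +>\<^bsub>M\<^esub> y) = X +>\<^bsub>M\<^esub> (x \<oplus>\<^bsub>M\<^esub> y)"
    if "x \<in> carrier M" "y \<in> carrier M" for x y
    using that by (simp add: quot_module_def X.a_rcos_sum)
  moreover have "carrier (quot_module M X) = (\<lambda>x. X +>\<^bsub>M\<^esub> x) ` carrier M"
    by (auto simp: quot_module_def A_RCOSETS_def')
  ultimately show ?thesis
    by (auto simp: rmodule_epi_def rmodule_hom_def ract_coset[OF X])
qed

lemma coset_eq_zero_iff:
  assumes X: "right_submodule R M X" and x: "x \<in> carrier M"
  shows "X +>\<^bsub>M\<^esub> x = \<zero>\<^bsub>quot_module M X\<^esub> \<longleftrightarrow> x \<in> X"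
proof -
  interpret X: abelian_subgroup X M using X by (rule abelian_subgroup_submodule)
  have "\<zero>\<^bsub>quot_module M X\<^esub> = X +>\<^bsub>M\<^esub> \<zero>\<^bsub>M\<^esub>" using X.a_subset by (simp add: quot_module_def)
  moreover have "x \<ominus>\<^bsub>M\<^esub> \<zero>\<^bsub>M\<^esub> = x"
    using x M.add.inv_one by (simp add: a_minus_def a_inv_def)
  ultimately show ?thesis using coset_eq_iff[OF X x, of "\<zero>\<^bsub>M\<^esub>"] by simp
qed

lemma decomposition_commute:
  assumes "direct_decomposition R M A B" shows "direct_decomposition R M B A"
proof -
  have "A \<subseteq> carrier M" "B \<subseteq> carrier M"
    using assms unfolding direct_decomposition_def right_submodule_iff by blast+
  then have "A <+>\<^bsub>M\<^esub> B = B <+>\<^bsub>M\<^esub> A"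
    by (auto simp: set_add_def' subset_iff) (metis M.a_comm)+
  then show ?thesis using assms by (auto simp: direct_decomposition_def)
qed

text \<open>Forgets that the projection has the summand as codomain. The result can be composed with
  maps defined on all of \<open>M\<close>, and the smaller codomain can be restored from the fact
  that all values lie in \<open>A\<close>.\<close>

lemma decomposition_projection_endo:
  assumes "direct_decomposition R M A B"
  shows "\<exists>\<pi>\<in>rmodule_hom R M M. (\<forall>x\<in>carrier M. \<pi> x \<in> A) \<and> (\<forall>a\<in>A. \<pi> a = a)"
proof -
  obtain \<pi> where pi: "\<pi> \<in> rmodule_hom R M (M\<lparr>carrier := A\<rparr>)" "\<forall>a\<in>A. \<pi> a = a"
    using decomposition_projection[OF assms] by blast
  have A: "A \<subseteq> carrier M"
    using assms unfolding direct_decomposition_def right_submodule_iff by blast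
  show ?thesis
  proof (intro bexI[of _ \<pi>] conjI ballI)
    show "\<pi> \<in> rmodule_hom R M M" using pi(1) A by (auto simp: rmodule_hom_def)
    show "\<pi> x \<in> A" if "x \<in> carrier M" for x using rmodule_homD(1)[OF pi(1) that] by simp
  qed (use pi(2) in blast)
qed

text \<open>Any \<open>X\<close> that complements \<open>K\<close> to all of \<open>M\<close> also
  complements the larger \<open>N\<close>, so the test for \<open>N\<close> already forces
  \<open>X\<close> to be everything.\<close>

lemma delta_small_subset:
  assumes N: "delta_small R M N" and K: "right_submodule R M K" "K \<subseteq> N"
  shows "delta_small R M K"
  unfolding delta_small_def
proof (intro conjI allI impI K(1))
  fix X
  assume X: "right_submodule R M X \<and> carrier M = K <+>\<^bsub>M\<^esub> X \<and> singular_module R (quot_module M X)"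
  have Ns: "right_submodule R M N" using N by (simp add: delta_small_def)
  then have "N <+>\<^bsub>M\<^esub> X \<subseteq> carrier M"
    using submodule_add[OF Ns, of X] X unfolding right_submodule_iff by blast
  moreover have "K <+>\<^bsub>M\<^esub> X \<subseteq> N <+>\<^bsub>M\<^esub> X" using K(2) unfolding subset_iff mem_set_add by blast
  ultimately have "carrier M = N <+>\<^bsub>M\<^esub> X" using X by blast
  then show "carrier M = X" using N X unfolding delta_small_def by blast
qed

end

section \<open>Homomorphisms and \<delta>-smallness\<close>

lemma rmodule_hom_vimage:
  assumes "right_module R M" "right_module R N" "f \<in> rmodule_hom R M N" "right_submodule R N X"
  shows "right_submodule R M {x \<in> carrier M. f x \<in> X}"
proof -
  interpret M: right_module R M by fact
  interpret N: right_module R N by fact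
  show ?thesis
    using assms(4) rmodule_homD[OF assms(3)] rmodule_hom_zero[OF assms(1-3)]
    unfolding M.right_submodule_iff N.right_submodule_iff by auto
qed

lemma delta_small_image:
  assumes M: "right_module R M" and N: "right_module R N" and f: "f \<in> rmodule_hom R M N"
    and K: "delta_small R M K"
  shows "delta_small R N (f ` K)"
  unfolding delta_small_def
proof (intro conjI allI impI)
  interpret M: right_module R M by (rule M)
  interpret N: right_module R N by (rule N)
  note f' = rmodule_homD[OF f]
  have Ks: "right_submodule R M K" using K by (simp add: delta_small_def)
  then have Kc: "k \<in> carrier M" if "k \<in> K" for k using that by (auto simp: M.right_submodule_iff)
  show "right_submodule R N (f ` K)" using rmodule_hom_image[OF M N f Ks] .
  fix X
  assume *: "right_submodule R N X \<and> carrier N = f ` K <+>\<^bsub>N\<^esub> X \<and> singular_module R (quot_module N X)"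
  then have X: "right_submodule R N X" and sum: "carrier N = f ` K <+>\<^bsub>N\<^esub> X" by auto
  then have Xc: "x \<in> carrier N" if "x \<in> X" for x using that by (auto simp: N.right_submodule_iff)
  let ?Y = "{x \<in> carrier M. f x \<in> X}"
  have Y: "right_submodule R M ?Y" using rmodule_hom_vimage[OF M N f X] .
  have "singular_module R (quot_module M ?Y)"
    unfolding M.singular_quot_iff[OF Y]
  proof
    fix x assume x: "x \<in> carrier M"
    \<comment> \<open>The cosets of \<open>x\<close> and of \<open>f x\<close> have the same
      annihilator; this is all that singularity needs from the embedding of quotients.\<close>
    have "{r \<in> carrier R. x \<cdot>\<^bsub>M\<^esub> r \<in> ?Y} = {r \<in> carrier R. f x \<cdot>\<^bsub>N\<^esub> r \<in> X}"
      using x f'(3) by auto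
    then show "essential_submodule R (regular_module R) {r \<in> carrier R. x \<cdot>\<^bsub>M\<^esub> r \<in> ?Y}"
      using * N.singular_quot_iff[OF X] f'(1)[OF x] by simp
  qed
  moreover have "carrier M = K <+>\<^bsub>M\<^esub> ?Y"
  proof
    show "K <+>\<^bsub>M\<^esub> ?Y \<subseteq> carrier M" using Kc by (intro M.M.setadd_subset_G) auto
    show "carrier M \<subseteq> K <+>\<^bsub>M\<^esub> ?Y"
    proof
      fix m assume m: "m \<in> carrier M"
      then have "f m \<in> f ` K <+>\<^bsub>N\<^esub> X" using f'(1) sum by blast
      then obtain k x where kx: "k \<in> K" "x \<in> X" "f m = f k \<oplus>\<^bsub>N\<^esub> x"
        unfolding N.mem_set_add by blast
      have k: "k \<in> carrier M" using kx Kc by blast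
      \<comment> \<open>The difference of \<open>m\<close> and \<open>k\<close>, written with the
        action of -1 so that the two homomorphism laws in \<open>f'\<close> suffice to compute its
        image.\<close>
      let ?y = "k \<cdot>\<^bsub>M\<^esub> (\<ominus>\<^bsub>R\<^esub> \<one>\<^bsub>R\<^esub>) \<oplus>\<^bsub>M\<^esub> m"
      have "f ?y = f k \<cdot>\<^bsub>N\<^esub> (\<ominus>\<^bsub>R\<^esub> \<one>\<^bsub>R\<^esub>) \<oplus>\<^bsub>N\<^esub> (f k \<oplus>\<^bsub>N\<^esub> x)" using f' k m kx(3) by simp
      also have "\<dots> = x" using f'(1)[OF k] Xc[OF kx(2)] by (simp add: N.ract_minus_one N.M.r_neg1)
      finally have "?y \<in> ?Y" using kx k m by simp
      moreover have "m = k \<oplus>\<^bsub>M\<^esub> ?y" using k m by (simp add: M.ract_minus_one M.M.r_neg2)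
      ultimately show "m \<in> K <+>\<^bsub>M\<^esub> ?Y" unfolding M.mem_set_add using kx(1) by blast
    qed
  qed
  ultimately have "carrier M = ?Y" using K Y unfolding delta_small_def by blast
  then have "f ` K \<subseteq> X" using Kc by blast
  then have "f ` K <+>\<^bsub>N\<^esub> X \<subseteq> X"
    using X unfolding N.right_submodule_iff by (auto simp: N.mem_set_add subset_iff)
  then have "carrier N \<subseteq> X" using sum by simp
  then show "carrier N = X" using Xc by blast
qed

section \<open>Projectivity of direct summands and of the regular module\<close>

lemma projective_summand:
  fixes M :: "('a, 'b) rmodule"
  assumes proj: "projective_module R M" and dec: "direct_decomposition R M A B"
  shows "projective_module R (M\<lparr>carrier := A\<rparr>)"
  unfolding projective_module_def
proof (intro conjI allI impI ballI)
  interpret M: right_module R M using proj by (simp add: projective_module_def)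
  have A: "right_submodule R M A" using dec by (simp add: direct_decomposition_def)
  have Ac: "a \<in> carrier M" if "a \<in> A" for a using A that by (auto simp: M.right_submodule_iff)
  show "right_module R (M\<lparr>carrier := A\<rparr>)" using A by (rule M.submodule_right_module)
  obtain \<pi> where pi: "\<pi> \<in> rmodule_hom R M M" "\<And>x. x \<in> carrier M \<Longrightarrow> \<pi> x \<in> A"
    "\<And>a. a \<in> A \<Longrightarrow> \<pi> a = a"
    using M.decomposition_projection_endo[OF dec] by blast
  fix K :: "('a, 'b \<Rightarrow> 'a) rmodule" and N :: "('a, 'b) rmodule" and g f
  assume KN: "right_module R K \<and> right_module R N" and g: "g \<in> rmodule_epi R K N"
    and f: "f \<in> rmodule_hom R (M\<lparr>carrier := A\<rparr>) N"
  \<comment> \<open>Precomposing with \<pi> extends \<open>f\<close> from \<open>A\<close> to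
    \<open>M\<close>. A lift of this extension, restricted to \<open>A\<close>, lifts
    \<open>f\<close> because \<pi> fixes \<open>A\<close>.\<close>
  have "\<pi> \<in> rmodule_hom R M (M\<lparr>carrier := A\<rparr>)" using pi by (auto simp: rmodule_hom_def)
  then have "(\<lambda>x. f (\<pi> x)) \<in> rmodule_hom R M N" using f by (rule rmodule_hom_comp)
  from projective_lift[OF proj conjunct1[OF KN] conjunct2[OF KN] g this]
  obtain h where h: "h \<in> rmodule_hom R M K" "\<And>x. x \<in> carrier M \<Longrightarrow> g (h x) = f (\<pi> x)" by blast
  show "\<exists>h\<in>rmodule_hom R (M\<lparr>carrier := A\<rparr>) K. \<forall>x\<in>carrier (M\<lparr>carrier := A\<rparr>). g (h x) = f x"
  proof (intro bexI[of _ h] ballI)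
    show "h \<in> rmodule_hom R (M\<lparr>carrier := A\<rparr>) K" using h(1) Ac by (auto simp: rmodule_hom_def)
  qed (use h(2) pi(3) Ac in auto)
qed

text \<open>The regular module is free on the identity: a homomorphism out of it is determined by
  its value at \<open>\<one>\<close>, and lifting that one value to some \<open>m\<close> gives the
  lift \<open>m r\<close>.\<close>

lemma (in ring) projective_regular: "projective_module R (regular_module R)"
  unfolding projective_module_def
proof (intro conjI allI impI ballI right_module_regular)
  fix M :: "('a, 'a \<Rightarrow> 'a) rmodule" and N :: "('a, 'a) rmodule" and g f
  assume "right_module R M \<and> right_module R N" and g: "g \<in> rmodule_epi R M N"
    and f: "f \<in> rmodule_hom R (regular_module R) N"
  then interpret M: right_module R M by simp
  have rs [simp]: "carrier (regular_module R) = carrier R"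
    "a \<oplus>\<^bsub>regular_module R\<^esub> b = a \<oplus> b" "a \<cdot>\<^bsub>regular_module R\<^esub> b = a \<otimes> b" for a b
    by (simp_all add: regular_module_def)
  have g': "g \<in> rmodule_hom R M N" "g ` carrier M = carrier N" using g by (auto simp: rmodule_epi_def)
  have "f \<one> \<in> carrier N" using rmodule_homD(1)[OF f, of "\<one>"] by simp
  then obtain m where m: "m \<in> carrier M" "g m = f \<one>" using g'(2) by (metis imageE)
  show "\<exists>h\<in>rmodule_hom R (regular_module R) M. \<forall>x\<in>carrier (regular_module R). g (h x) = f x"
  proof (intro bexI[of _ "\<lambda>r. m \<cdot>\<^bsub>M\<^esub> r"] ballI)
    show "(\<lambda>r. m \<cdot>\<^bsub>M\<^esub> r) \<in> rmodule_hom R (regular_module R) M"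
      using m by (auto simp: rmodule_hom_def M.ract_r_distr M.ract_assoc)
    fix r assume "r \<in> carrier (regular_module R)"
    then show "g (m \<cdot>\<^bsub>M\<^esub> r) = f r"
      using rmodule_homD(3)[OF g'(1) m(1), of r] rmodule_homD(3)[OF f, of "\<one>" r] m(2) by simp
  qed
qed

section \<open>From a projective \<delta>-cover of a quotient to a decomposition, and back\<close>

lemma quot_delta_cover_imp_decomposition:
  fixes M :: "('a, 'b) rmodule"
  assumes proj: "projective_module R M" and N: "right_submodule R M N"
    and cover: "has_projective_delta_cover R (quot_module M N)"
  shows "\<exists>A B. direct_decomposition R M A B \<and> A \<subseteq> N \<and> delta_small R (M\<lparr>carrier := B\<rparr>) (N \<inter> B)"
proof -
  have Mm: "right_module R M" using proj by (simp add: projective_module_def)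
  interpret M: right_module R M by (rule Mm)
  let ?Q = "quot_module M N"
  have Qm: "right_module R ?Q" using N by (rule M.quot_right_module)
  obtain P :: "('a, 'b set \<Rightarrow> 'a) rmodule" and f where Pproj: "projective_module R P"
    and f: "f \<in> rmodule_epi R P ?Q" and K: "delta_small R P (a_kernel P ?Q f)"
    using cover by (auto simp: has_projective_delta_cover_def projective_delta_cover_def)
  let ?K = "a_kernel P ?Q f"
  have Pm: "right_module R P" using Pproj by (simp add: projective_module_def)
  interpret P: right_module R P by (rule Pm)
  note f' = rmodule_homD[OF rmodule_epi_hom[OF f]]
  obtain h where h: "h \<in> rmodule_hom R M P" "\<And>x. x \<in> carrier M \<Longrightarrow> f (h x) = N +>\<^bsub>M\<^esub> x"
    using projective_lift[OF proj Pm Qm f rmodule_epi_hom[OF M.coset_epi[OF N]]] by blast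
  note h' = rmodule_homD[OF h(1)]
  \<comment> \<open>As \<open>f\<close> after \<open>h\<close> is the projection of \<open>M\<close>
    onto the quotient, \<open>N\<close> is exactly the preimage of \<open>?K\<close> under
    \<open>h\<close>.\<close>
  have hK: "h x \<in> ?K \<longleftrightarrow> x \<in> N" if "x \<in> carrier M" for x
    using that h'(1) h(2) M.coset_eq_zero_iff[OF N] by (simp add: a_kernel_def')
  define X where "X = h ` carrier M"
  have X: "right_submodule R P X"
    unfolding X_def by (rule rmodule_hom_image[OF Mm Pm h(1) right_submodule_carrier[OF Mm]])
  have Xc: "x \<in> carrier P" if "x \<in> X" for x using that X by (auto simp: P.right_submodule_iff)
  interpret Q: right_module R ?Q by (rule Qm)
  have "carrier P = X <+>\<^bsub>P\<^esub> ?K"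
  proof
    show "X <+>\<^bsub>P\<^esub> ?K \<subseteq> carrier P"
      using Xc by (intro P.M.setadd_subset_G) (auto simp: a_kernel_def')
    show "carrier P \<subseteq> X <+>\<^bsub>P\<^esub> ?K"
    proof
      fix p assume p: "p \<in> carrier P"
      \<comment> \<open>The value \<open>f p\<close> is the coset of some \<open>x\<close>, which is
        also \<open>f (h x)\<close>; so \<open>p\<close> and \<open>h x\<close> differ by an element
        of \<open>?K\<close>.\<close>
      have "f p \<in> (\<lambda>x. N +>\<^bsub>M\<^esub> x) ` carrier M"
        using M.coset_epi[OF N] f'(1)[OF p] by (simp add: rmodule_epi_def)
      then obtain x where x: "x \<in> carrier M" "f p = f (h x)" using h(2) by auto
      have hx: "h x \<in> carrier P" using h'(1) x(1) .
      let ?k = "h x \<cdot>\<^bsub>P\<^esub> (\<ominus>\<^bsub>R\<^esub> \<one>\<^bsub>R\<^esub>) \<oplus>\<^bsub>P\<^esub> p"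
      have "f ?k = \<zero>\<^bsub>?Q\<^esub>"
        using f' hx p x(2) by (simp add: Q.ract_minus_one Q.M.l_neg)
      then have "?k \<in> ?K" using hx p by (simp add: a_kernel_def')
      moreover have "p = h x \<oplus>\<^bsub>P\<^esub> ?k" using hx p by (simp add: P.ract_minus_one P.M.r_neg2)
      ultimately show "p \<in> X <+>\<^bsub>P\<^esub> ?K" unfolding P.mem_set_add X_def using x(1) by blast
    qed
  qed
  \<comment> \<open>Smallness only gives \<open>X\<close> a complement; it does not make
    \<open>X\<close> all of \<open>P\<close>. The projection \<pi> onto \<open>X\<close> accounts
    for the difference from here on.\<close>
  from P.delta_small_complement[OF X K this] obtain Y where "direct_decomposition R P X Y"
    by blast
  from P.decomposition_projection_endo[OF this] obtain \<pi> where pi: "\<pi> \<in> rmodule_hom R P P"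
    "\<And>p. p \<in> carrier P \<Longrightarrow> \<pi> p \<in> X" "\<And>x. x \<in> X \<Longrightarrow> \<pi> x = x"
    by blast
  note pi' = rmodule_homD[OF pi(1)]
  let ?X = "P\<lparr>carrier := X\<rparr>"
  have "\<pi> \<in> rmodule_hom R P ?X" using pi by (auto simp: rmodule_hom_def)
  moreover have "h \<in> rmodule_epi R M ?X"
    using h(1) by (auto simp: rmodule_epi_def rmodule_hom_def X_def)
  \<comment> \<open>Lifting \<pi> along \<open>h\<close> uses the projectivity of \<open>P\<close>
    directly. On \<open>X\<close>, where \<pi> is the identity, \<open>s\<close> is a section of
    \<open>h\<close>.\<close>
  ultimately obtain s where s: "s \<in> rmodule_hom R P M" "\<And>p. p \<in> carrier P \<Longrightarrow> h (s p) = \<pi> p"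
    using projective_lift[OF Pproj Mm P.submodule_right_module[OF X]] by blast
  \<comment> \<open>The extra \<pi> makes \<open>g\<close> depend only on the component in
    \<open>X\<close> (fact \<open>gpi\<close>), which \<open>s\<close> alone need not do. As a
    result \<open>h\<close> and \<open>g\<close> are mutually inverse between \<open>B\<close> and
    \<open>X\<close>.\<close>
  define g where "g = (\<lambda>p. s (\<pi> p))"
  have g: "g \<in> rmodule_hom R P M" unfolding g_def by (rule rmodule_hom_comp[OF pi(1) s(1)])
  note g' = rmodule_homD[OF g]
  have hg: "h (g p) = \<pi> p" if "p \<in> carrier P" for p
    using that s(2) pi pi' by (simp add: g_def)
  have gpi: "g (\<pi> p) = g p" if "p \<in> carrier P" for p using that pi by (simp add: g_def)
  have hX: "\<pi> (h x) = h x" if "x \<in> carrier M" for x using that pi(3) by (simp add: X_def)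
  define A where "A = a_kernel M P h"
  define B where "B = g ` carrier P"
  have A: "right_submodule R M A" unfolding A_def by (rule rmodule_hom_kernel[OF Mm Pm h(1)])
  have B: "right_submodule R M B"
    unfolding B_def by (rule rmodule_hom_image[OF Pm Mm g right_submodule_carrier[OF Pm]])
  have Bc: "b \<in> carrier M" if "b \<in> B" for b using that B by (auto simp: M.right_submodule_iff)
  have ghB: "g (h b) = b" if b: "b \<in> B" for b
  proof -
    obtain p where "p \<in> carrier P" "b = g p" using b by (auto simp: B_def)
    then show ?thesis using hg gpi by simp
  qed
  have "direct_decomposition R M A B"
    unfolding direct_decomposition_def
  proof (intro conjI A B)
    show "carrier M = A <+>\<^bsub>M\<^esub> B"
    proof
      show "A <+>\<^bsub>M\<^esub> B \<subseteq> carrier M"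
        using Bc by (intro M.M.setadd_subset_G) (auto simp: A_def a_kernel_def')
      show "carrier M \<subseteq> A <+>\<^bsub>M\<^esub> B"
      proof
        fix m assume m: "m \<in> carrier M"
        \<comment> \<open>The composite of \<open>h\<close> followed by \<open>g\<close> is the
          projection of \<open>M\<close> onto \<open>B\<close> along \<open>A\<close>, so
          \<open>m\<close> splits into this value and a remainder killed by
          \<open>h\<close>.\<close>
        let ?b = "g (h m)"
        have b: "?b \<in> carrier M" "?b \<in> B" using m h' g' by (auto simp: B_def)
        let ?a = "m \<oplus>\<^bsub>M\<^esub> ?b \<cdot>\<^bsub>M\<^esub> (\<ominus>\<^bsub>R\<^esub> \<one>\<^bsub>R\<^esub>)"
        have "h ?a = h m \<oplus>\<^bsub>P\<^esub> h m \<cdot>\<^bsub>P\<^esub> (\<ominus>\<^bsub>R\<^esub> \<one>\<^bsub>R\<^esub>)" using m b h' hg hX by simp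
        also have "\<dots> = \<zero>\<^bsub>P\<^esub>" using m h' by (simp add: P.ract_minus_one P.M.r_neg)
        finally have "?a \<in> A" using m b by (simp add: A_def a_kernel_def')
        moreover have "m = ?a \<oplus>\<^bsub>M\<^esub> ?b"
          using m b by (simp add: M.ract_minus_one M.M.a_assoc M.M.l_neg)
        ultimately show "m \<in> A <+>\<^bsub>M\<^esub> B" unfolding M.mem_set_add using b(2) by blast
      qed
    qed
    have "x = \<zero>\<^bsub>M\<^esub>" if "x \<in> A" "x \<in> B" for x
      using that ghB[of x] rmodule_hom_zero[OF Pm Mm g] by (simp add: A_def a_kernel_def')
    then show "A \<inter> B = {\<zero>\<^bsub>M\<^esub>}" using A B by (auto simp: M.right_submodule_iff)
  qed
  moreover have "A \<subseteq> N"
  proof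
    fix a assume "a \<in> A"
    then have a: "a \<in> carrier M" "h a = \<zero>\<^bsub>P\<^esub>" by (auto simp: A_def a_kernel_def')
    have "h a \<in> ?K"
      using a rmodule_hom_zero[OF Pm Qm rmodule_epi_hom[OF f]] by (simp add: a_kernel_def')
    then show "a \<in> N" using hK a by blast
  qed
  moreover have "delta_small R (M\<lparr>carrier := B\<rparr>) (N \<inter> B)"
  proof -
    have Bm: "right_module R (M\<lparr>carrier := B\<rparr>)" using B by (rule M.submodule_right_module)
    \<comment> \<open>With \<open>B\<close> as the codomain of \<open>g\<close>, the image of the
      kernel is small in \<open>B\<close> itself and not merely in \<open>M\<close>.\<close>
    have "g \<in> rmodule_hom R P (M\<lparr>carrier := B\<rparr>)" using g by (auto simp: rmodule_hom_def B_def)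
    from delta_small_image[OF Pm Bm this K]
    have "delta_small R (M\<lparr>carrier := B\<rparr>) (g ` ?K)" .
    moreover have "N \<inter> B \<subseteq> g ` ?K"
    proof
      fix x assume "x \<in> N \<inter> B"
      then have "h x \<in> ?K" "x = g (h x)" using hK Bc ghB by auto
      then show "x \<in> g ` ?K" by blast
    qed
    moreover have "right_submodule R (M\<lparr>carrier := B\<rparr>) (N \<inter> B)"
      unfolding M.submodule_submodule[OF B] using N B by (auto simp: M.right_submodule_iff)
    ultimately show ?thesis by (metis right_module.delta_small_subset[OF Bm])
  qed
  ultimately show ?thesis by blast
qed

lemma decomposition_imp_quot_delta_cover:
  fixes M :: "('a, 'b) rmodule"
  assumes proj: "projective_module R M" and N: "right_submodule R M N"
    and dec: "direct_decomposition R M A B" and AN: "A \<subseteq> N"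
    and small: "delta_small R (M\<lparr>carrier := B\<rparr>) (N \<inter> B)"
  shows "has_projective_delta_cover R (quot_module M N)"
proof -
  interpret M: right_module R M using proj by (simp add: projective_module_def)
  let ?Q = "quot_module M N" and ?B = "M\<lparr>carrier := B\<rparr>" and ?f = "\<lambda>x. N +>\<^bsub>M\<^esub> x"
  have AB: "right_submodule R M A" "right_submodule R M B" "carrier M = A <+>\<^bsub>M\<^esub> B"
    using dec by (auto simp: direct_decomposition_def)
  have Ac: "a \<in> carrier M" if "a \<in> A" for a using that AB(1) by (auto simp: M.right_submodule_iff)
  have Bc: "b \<in> carrier M" if "b \<in> B" for b using that AB(2) by (auto simp: M.right_submodule_iff)
  have f: "?f \<in> rmodule_hom R M ?Q" "?f ` carrier M = carrier ?Q"
    using M.coset_epi[OF N] by (auto simp: rmodule_epi_def)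
  have "?f ` carrier M \<subseteq> ?f ` B"
  proof
    fix y assume "y \<in> ?f ` carrier M"
    then obtain a b where ab: "a \<in> A" "b \<in> B" "y = ?f (a \<oplus>\<^bsub>M\<^esub> b)"
      using AB(3) by (auto simp: M.mem_set_add)
    have c: "a \<in> carrier M" "b \<in> carrier M" using ab Ac Bc by auto
    then have "(a \<oplus>\<^bsub>M\<^esub> b) \<ominus>\<^bsub>M\<^esub> b = a" by (simp add: a_minus_def M.M.a_assoc M.M.r_neg)
    \<comment> \<open>The component \<open>a\<close> lies in \<open>N\<close>, so it vanishes in the
      quotient and \<open>b\<close> represents the same coset.\<close>
    then have "y = ?f b"
      using M.coset_eq_iff[OF N, of "a \<oplus>\<^bsub>M\<^esub> b" b] c ab AN by auto
    then show "y \<in> ?f ` B" using ab(2) by blast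
  qed
  moreover have "?f ` B \<subseteq> ?f ` carrier M" using Bc by (intro image_mono subsetI)
  ultimately have "?f ` B = carrier ?Q" using f(2) by (simp add: subset_antisym)
  then have "?f \<in> rmodule_epi R ?B ?Q"
    using f(1) Bc by (auto simp: rmodule_epi_def rmodule_hom_def)
  moreover have "a_kernel ?B ?Q ?f = N \<inter> B"
    using M.coset_eq_zero_iff[OF N Bc] by (auto simp: a_kernel_def')
  \<comment> \<open>The summand lemma speaks of the first component, hence the exchange of
    \<open>A\<close> and \<open>B\<close>.\<close>
  moreover have "projective_module R ?B"
    using proj M.decomposition_commute[OF dec] by (rule projective_summand)
  ultimately have "projective_delta_cover R ?B ?f ?Q"
    using small by (simp add: projective_delta_cover_def)
  \<comment> \<open>The cover \<open>?B\<close> has elements of type \<open>'b\<close>, while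
    \<open>has_projective_delta_cover\<close> asks for one whose elements are functions on cosets;
    the lemma used here replaces the cover accordingly.\<close>
  with M.quot_right_module[OF N] show ?thesis by (rule has_projective_delta_coverI)
qed

section \<open>The equivalence of the three properties\<close>

lemma projective_delta_semiperfect_iff_lifting:
  assumes proj: "projective_module R M"
  shows "principally_delta_semiperfect R M \<longleftrightarrow> principally_delta_lifting R M"
proof -
  interpret M: right_module R M using proj by (simp add: projective_module_def)
  have "has_projective_delta_cover R (quot_module M N) \<longleftrightarrow>
      (\<exists>A B. direct_decomposition R M A B \<and> A \<subseteq> N \<and> delta_small R (M\<lparr>carrier := B\<rparr>) (N \<inter> B))"
    if "right_submodule R M N" for N
    using quot_delta_cover_imp_decomposition[OF proj that]
      decomposition_imp_quot_delta_cover[OF proj that] by blast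
  then show ?thesis
    by (simp add: principally_delta_semiperfect_def principally_delta_lifting_def
        M.principal_right_submodule)
qed

text \<open>Semiperfectness concerns the quotients \<open>?N a\<close> themselves, semiregularity
  their isomorphic copies. One direction transports covers along isomorphisms; the other takes the
  identity as the isomorphism.\<close>

lemma (in ring) delta_semiperfect_iff_semiregular:
  "principally_delta_semiperfect_ring R \<longleftrightarrow> delta_semiregular_ring R"
proof -
  interpret Reg: right_module R "regular_module R" by (rule right_module_regular)
  have c [simp]: "carrier (regular_module R) = carrier R" by (simp add: regular_module_def)
  let ?N = "\<lambda>a. quot_module (regular_module R) (principal_submodule R (regular_module R) a)"
  have N: "right_module R (?N a)" if "a \<in> carrier R" for a
    using that by (intro Reg.quot_right_module Reg.principal_right_submodule) simp
  show ?thesis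
  proof
    assume *: "principally_delta_semiperfect_ring R"
    show "delta_semiregular_ring R"
      unfolding delta_semiregular_ring_def
    proof (intro allI impI)
      fix L :: "('a, 'a set) rmodule"
      assume "cyclically_presented R L"
      then obtain a where L: "right_module R L" and a: "a \<in> carrier R" "rmodule_isomorphic R L (?N a)"
        by (auto simp: cyclically_presented_def)
      \<comment> \<open>Both \<open>L\<close> and \<open>?N a\<close> have elements of type
        \<open>'a set\<close>, so a cover of one already has the type required for the
        other.\<close>
      obtain P :: "('a, 'a set \<Rightarrow> 'a) rmodule" and q where "projective_delta_cover R P q (?N a)"
        using * a(1) by (auto simp: principally_delta_semiperfect_ring_def
            principally_delta_semiperfect_def has_projective_delta_cover_def)
      from projective_delta_cover_isomorphic[OF N[OF a(1)] L a(2) this]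
      show "has_projective_delta_cover R L" by (auto simp: has_projective_delta_cover_def)
    qed
  next
    assume *: "delta_semiregular_ring R"
    have "rmodule_isomorphic R (?N a) (?N a)" for a
      unfolding rmodule_isomorphic_def
      by (intro bexI[of _ "\<lambda>x. x"]) (auto simp: rmodule_hom_def bij_betw_def)
    then have "cyclically_presented R (?N a)" if "a \<in> carrier R" for a
      using N[OF that] that by (auto simp: cyclically_presented_def)
    then show "principally_delta_semiperfect_ring R"
      using * by (simp add: delta_semiregular_ring_def principally_delta_semiperfect_ring_def
          principally_delta_semiperfect_def)
  qed
qed

theorem corollary4p2:
  fixes R :: "('a, 'm) ring_scheme"
  assumes "ring R"
  shows "(principally_delta_semiperfect_ring R \<longleftrightarrow> principally_delta_lifting_ring R) \<and>
         (principally_delta_lifting_ring R \<longleftrightarrow> delta_semiregular_ring R)"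
proof -
  interpret ring R by (rule assms)
  have "principally_delta_semiperfect_ring R \<longleftrightarrow> principally_delta_lifting_ring R"
    using projective_delta_semiperfect_iff_lifting[OF projective_regular]
    by (simp add: principally_delta_semiperfect_ring_def principally_delta_lifting_ring_def)
  then show ?thesis using delta_semiperfect_iff_semiregular by blast
qed

end
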